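(* For all integers $n\ge k\ge0$, \[ \tilde\sigma^{AW,H}_{n,k}(a_1,a_2,a_3,a_4;q)=\sum_{\mathbf T\in\mathcal T_{n,k}}\mathbf a^{s(\mathbf T)}\,q^{\lVert\mathbf T\rVert_{n,k}}\begin{bmatrix}n\\k,m(\mathbf T)\end{bmatrix}_q . \]
   Context: The set $\mathcal T$. Let $\mathcal T$ be the set of quadruples $(t_1,t_2,t_3,t_4)$ of nonnegative integers such that $t_1+t_2+t_3+t_4$ is odd and $|t_i-t_j|\le1$ for all $1\le i,j\le4$. It is totally ordered by: $(t_1,t_2,t_3,t_4)\le(s_1,s_2,s_3,s_4)$ if and only if $(t_4,t_3,t_2,-t_1)\le(s_4,s_3,s_2,-s_1)$ in lexicographic order. For $T=(t_1,t_2,t_3,t_4)$ put $\mathbf a^T=a_1^{t_1}a_2^{t_2}a_3^{t_3}a_4^{t_4}$ and $|T|=t_1+t_2+t_3+t_4$. For $n\ge k\ge0$ let \[ \mathcal T_{n,k}=\{(T_k,T_{k+1},\dots,T_{n-1})\in\mathcal T^{n-k}:T_k\ge T_{k+1}\ge\cdots\ge T_{n-1}\}. \] For $\mathbf T=(T_k,\dots,T_{n-1})\in\mathcal T_{n,k}$ let $s(\mathbf T)=T_k+\cdots+T_{n-1}$ (componentwise sum), let $m(\mathbf T)=(m_1,\dots,m_r)$ be the sequence of positive integers with $m_1+\cdots+m_r=n-k$ giving the lengths of the maximal runs of equal entries, i.e. $T_k=\cdots=T_{k+m_1-1}>T_{k+m_1}=\cdots=T_{k+m_1+m_2-1}>\cdots>T_{k+m_1+\cdots+m_{r-1}}=\cdots=T_{n-1}$,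 and let \[ \lVert\mathbf T\rVert_{n,k}=\sum_{i=k}^{n-1}\frac{i(|T_i|-1)}2,\qquad \begin{bmatrix}n\\k,m(\mathbf T)\end{bmatrix}_q=\frac{[n]_q!}{[k]_q!\,[m_1]_q!\cdots[m_r]_q!}, \] where $[n]_q!=\prod_{i=1}^n\frac{1-q^i}{1-q}$. Polynomials. Write $(z;q)_n=\prod_{i=0}^{n-1}(1-zq^i)$, $(z_1,\dots,z_r;q)_n=\prod_s(z_s;q)_n$, and ${}_r\phi_s(\alpha_1,\dots,\alpha_r;\beta_1,\dots,\beta_s;q,z)=\sum_{k\ge0}\frac{(\alpha_1,\dots,\alpha_r;q)_k}{(q,\beta_1,\dots,\beta_s;q)_k}\big((-1)^kq^{\binom k2}\big)^{1+s-r}z^k$. With $x=\cos\theta$ and $\mathbf i=\sqrt{-1}$, the monic Askey--Wilson polynomials are \[ p_n(x;a,b,c,d|q)=\frac{(ab,ac,ad;q)_n}{2^na^n(abcdq^{n-1};q)_n}\;{}_4\phi_3\!\left(\begin{matrix}q^{-n},\,abcdq^{n-1},\,ae^{\mathbf i\theta},\,ae^{-\mathbf i\theta}\\ ab,\,ac,\,ad\end{matrix};q,q\right), \] and the monic continuous $q$-Hermite polynomials are $H_n(x|q)=\frac{e^{\mathbf in\theta}}{2^n}\,{}_2\phi_0\!\left(\begin{matrix}q^{-n},0\\-\end{matrix};q,q^ne^{-2\mathbf i\theta}\right)$. Define $\sigma^{AW,H}_{n,k}$ by $H_n(x|q)=\sum_{k=0}^n\sigma^{AW,H}_{n,k}(a,b,c,d;q)\,p_k(x;a,b,c,d|q)$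 and \[ \tilde\sigma^{AW,H}_{n,k}(a,b,c,d;q)=\frac{2^{n-k}}{\mathbf i^{\,n-k}}\sigma^{AW,H}_{n,k}(\mathbf ia,\mathbf ib,\mathbf ic,\mathbf id;q). \] The parameters $a_1,a_2,a_3,a_4$ are used in place of $a,b,c,d$; the identity is one of formal power series in the indeterminates $a_1,a_2,a_3,a_4$ with coefficients in $\mathbb{Q}(q)$. *)

theory Defs
  imports "HOL-Computational_Algebra.Computational_Algebra"
begin

definition qpoch :: "'a::field \<Rightarrow> 'a \<Rightarrow> nat \<Rightarrow> 'a" where
  "qpoch z q n = (\<Prod>i<n. 1 - z * q ^ i)"

definition qpochs :: "'a::field list \<Rightarrow> 'a \<Rightarrow> nat \<Rightarrow> 'a" where
  "qpochs zs q n = prod_list (map (\<lambda>z. qpoch z q n) zs)"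

definition phi_term :: "'a::field list \<Rightarrow> 'a list \<Rightarrow> 'a \<Rightarrow> 'a \<Rightarrow> nat \<Rightarrow> 'a" where
  "phi_term as bs q z k =
     qpochs as q k / qpochs (q # bs) q k
     * ((- 1) ^ k * q ^ (k choose 2)) powi (1 + int (length bs) - int (length as)) * z ^ k"

text \<open>Only terminating series are used (some upper parameter is \<open>q\<^sup>-\<^sup>n\<close>), so the series is the
  sum of its finitely many nonzero terms.\<close>

definition phi :: "'a::field list \<Rightarrow> 'a list \<Rightarrow> 'a \<Rightarrow> 'a \<Rightarrow> 'a" where
  "phi as bs q z = (\<Sum>k | phi_term as bs q z k \<noteq> 0. phi_term as bs q z k)"

text \<open>The polynomials are needed over a field of formal expressions. There \<open>e\<^sup>i\<^sup>\<theta>\<close> becomes an arbitrary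
  nonzero field element \<open>z\<close>, and \<open>x = cos \<theta>\<close> becomes \<open>(z + 1/z) / 2\<close>. The field is infinite, so
  these values determine a polynomial in \<open>x\<close>.\<close>

definition poly_of_cos :: "('a::field \<Rightarrow> 'a) \<Rightarrow> 'a poly" where
  "poly_of_cos f = (THE p. \<forall>z. z \<noteq> 0 \<longrightarrow> poly p ((z + 1 / z) / 2) = f z)"

definition askey_wilson :: "nat \<Rightarrow> 'a::field \<Rightarrow> 'a \<Rightarrow> 'a \<Rightarrow> 'a \<Rightarrow> 'a \<Rightarrow> 'a poly" where
  "askey_wilson n a b c d q = poly_of_cos (\<lambda>z.
     qpochs [a * b, a * c, a * d] q n
       / (2 ^ n * a ^ n * qpoch (a * b * c * d * q powi (int n - 1)) q n)
     * phi [q powi (- int n), a * b * c * d * q powi (int n - 1), a * z, a / z]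
           [a * b, a * c, a * d] q q)"

definition q_hermite :: "nat \<Rightarrow> 'a::field \<Rightarrow> 'a poly" where
  "q_hermite n q = poly_of_cos (\<lambda>z.
     z ^ n / 2 ^ n * phi [q powi (- int n), 0] [] q (q ^ n * z powi (- 2)))"

definition sigma_AW_H :: "nat \<Rightarrow> nat \<Rightarrow> 'a::field \<Rightarrow> 'a \<Rightarrow> 'a \<Rightarrow> 'a \<Rightarrow> 'a \<Rightarrow> 'a" where
  "sigma_AW_H n k a b c d q =
     (THE s :: nat \<Rightarrow> 'a.
        q_hermite n q = (\<Sum>j\<le>n. smult (s j) (askey_wilson j a b c d q)) \<and> (\<forall>j>n. s j = 0)) k"

text \<open>The first argument \<open>\<iota>\<close> is the square root of \<open>-1\<close> in the field.\<close>

definition sigma_tilde :: "'a::field \<Rightarrow> nat \<Rightarrow> nat \<Rightarrow> 'a \<Rightarrow> 'a \<Rightarrow> 'a \<Rightarrow> 'a \<Rightarrow> 'a \<Rightarrow> 'a" where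
  "sigma_tilde \<iota> n k a b c d q =
     2 ^ (n - k) / \<iota> ^ (n - k) * sigma_AW_H n k (\<iota> * a) (\<iota> * b) (\<iota> * c) (\<iota> * d) q"

text \<open>Scalars are taken in \<open>\<complex>(q)\<close> rather than \<open>\<rat>(q)\<close>, because the definition of
  \<^const>\<open>sigma_tilde\<close> passes through \<open>\<i>\<close>. The ring of formal power series in \<open>a\<^sub>1, \<dots>, a\<^sub>4\<close> is the
  iterated one, with \<open>a\<^sub>1\<close> the innermost variable.\<close>

type_synonym scalar = "complex poly fract"
type_synonym series = "scalar fps fps fps fps"

definition q_var :: scalar where "q_var = to_fract [:0, 1:]"

definition series_const :: "scalar \<Rightarrow> series" where
  "series_const c = fps_const (fps_const (fps_const (fps_const c)))"

definition a1 :: series where "a1 = fps_const (fps_const (fps_const fps_X))"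
definition a2 :: series where "a2 = fps_const (fps_const fps_X)"
definition a3 :: series where "a3 = fps_const fps_X"
definition a4 :: series where "a4 = fps_X"

type_synonym quad = "nat \<times> nat \<times> nat \<times> nat"

fun series_coeff :: "series \<Rightarrow> quad \<Rightarrow> scalar" where
  "series_coeff f (e1, e2, e3, e4) = f $ e4 $ e3 $ e2 $ e1"

fun a_monom :: "quad \<Rightarrow> series" where
  "a_monom (e1, e2, e3, e4) = a1 ^ e1 * a2 ^ e2 * a3 ^ e3 * a4 ^ e4"

text \<open>A possibly infinite family of power series has a sum if for each monomial only finitely many
  members contribute to its coefficient; the sum is then taken coefficientwise.\<close>

definition has_formal_sum :: "('i \<Rightarrow> series) \<Rightarrow> 'i set \<Rightarrow> series \<Rightarrow> bool" where
  "has_formal_sum f I S \<longleftrightarrow>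
     (\<forall>e. finite {i \<in> I. series_coeff (f i) e \<noteq> 0} \<and>
          series_coeff S e = (\<Sum>i | i \<in> I \<and> series_coeff (f i) e \<noteq> 0. series_coeff (f i) e))"

text \<open>The rational functions of the problem live in the field of fractions of the power series ring.\<close>

abbreviation emb :: "series \<Rightarrow> series fract" where "emb \<equiv> to_fract"

definition imag_unit :: "series fract" where
  "imag_unit = emb (series_const (to_fract [:\<i>:]))"

fun quad_size :: "quad \<Rightarrow> nat" where
  "quad_size (t1, t2, t3, t4) = t1 + t2 + t3 + t4"

definition Tset :: "quad set" where
  "Tset = {(t1, t2, t3, t4). odd (t1 + t2 + t3 + t4) \<and>
     (\<forall>x\<in>{t1, t2, t3, t4}. \<forall>y\<in>{t1, t2, t3, t4}. \<bar>int x - int y\<bar> \<le> 1)}"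

fun quad_le :: "quad \<Rightarrow> quad \<Rightarrow> bool" where
  "quad_le (t1, t2, t3, t4) (s1, s2, s3, s4) \<longleftrightarrow>
     ord_class.lexordp_eq [int t4, int t3, int t2, - int t1] [int s4, int s3, int s2, - int s1]"

text \<open>A tuple \<open>(T\<^sub>k, \<dots>, T\<^sub>n\<^sub>-\<^sub>1)\<close> is a list of length \<open>n - k\<close> with \<open>T\<^sub>i\<close> at position \<open>i - k\<close>.\<close>

definition Tnk :: "nat \<Rightarrow> nat \<Rightarrow> quad list set" where
  "Tnk n k = {Ts. length Ts = n - k \<and> set Ts \<subseteq> Tset \<and> sorted_wrt (\<lambda>S T. quad_le T S) Ts}"

definition tuple_sum :: "quad list \<Rightarrow> quad" where
  "tuple_sum Ts =
     (sum_list (map (\<lambda>(t1, t2, t3, t4). t1) Ts), sum_list (map (\<lambda>(t1, t2, t3, t4). t2) Ts),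
      sum_list (map (\<lambda>(t1, t2, t3, t4). t3) Ts), sum_list (map (\<lambda>(t1, t2, t3, t4). t4) Ts))"

text \<open>The lengths of the maximal runs of equal consecutive entries.\<close>

function run_lengths :: "'a list \<Rightarrow> nat list" where
  "run_lengths [] = []"
| "run_lengths (x # xs) =
     Suc (length (takeWhile (\<lambda>y. y = x) xs)) # run_lengths (dropWhile (\<lambda>y. y = x) xs)"
  by pat_completeness auto
termination
  by (relation "measure length") (auto simp: le_imp_less_Suc length_dropWhile_le)

text \<open>For entries of \<^const>\<open>Tset\<close> the size is odd, hence at least 1, so that both the subtraction
  and the division are exact.\<close>

definition norm_nk :: "nat \<Rightarrow> nat \<Rightarrow> quad list \<Rightarrow> nat" where
  "norm_nk n k Ts = (\<Sum>i = k..<n. i * (quad_size (Ts ! (i - k)) - 1) div 2)"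

definition qfact :: "'a::field \<Rightarrow> nat \<Rightarrow> 'a" where
  "qfact q n = (\<Prod>i = 1..n. (1 - q ^ i) / (1 - q))"

definition qmultinom :: "'a::field \<Rightarrow> nat \<Rightarrow> nat \<Rightarrow> nat list \<Rightarrow> 'a" where
  "qmultinom q n k ms = qfact q n / (qfact q k * prod_list (map (qfact q) ms))"

end

theory Submission
  imports Defs
begin

text \<open>Giving each quadruple \<open>T\<close> the lower triangular matrix with entries
  \<open>gbin n k * (\<Prod>i=k..<n. a\<^sup>T q\<^bsup>i(|T| - 1)/2\<^esup>)\<close>, the sum over decreasing tuples is the product of these
  matrices in increasing order of \<open>T\<close>, because the q-multinomial coefficients factor into q-binomial
  ones. By the q-binomial theorem the eight factors with a given value of \<open>t\<^sub>4 > 0\<close> merge into a single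
  matrix of the same kind, and the remaining infinite product is the solution of a fixed-point
  equation, namely the explicit connection matrix from the Askey--Wilson polynomials with \<open>d = 0\<close> to
  those with general \<open>d\<close>. The factors with \<open>t\<^sub>4 = 0\<close> are the connection matrices that start
  from the q-Hermite polynomials and introduce \<open>a\<close>, \<open>b\<close> and \<open>c\<close> one at a time.\<close>

section \<open>Gaussian binomials and triangular matrices\<close>

text \<open>The tuple sum lives in a ring of power series, the Askey--Wilson expansion in its
  fraction field. The matrix identities needed on the series side are therefore proved without
  division: \<open>gbin\<close> is defined by Pascal's rule, which commutes with ring embeddings,
  and reciprocals enter as given elements with product 1. No infinite matrix product is formed
  either: finite products carry a remainder matrix at their right end, and this remainder has a
  closed form.

  The four parameters do not enter symmetrically. The parameter a is the base of the expansion in (a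
  z, a / z; q)_j and occurs in denominators, so it cannot start from 0. Once a is present, one
  summation formula adds b, c and d; the step that introduces a is instead a comparison of
  three-term recurrences.

  The order on quadruples is what lets adjacent factors merge, and the twist by the imaginary unit
  supplies the plus signs in the merged factors such as 1 + a_1 a_2 q^i.\<close>

fun gbin :: "'a::comm_ring_1 \<Rightarrow> nat \<Rightarrow> nat \<Rightarrow> 'a" where
  "gbin q n 0 = 1"
| "gbin q 0 (Suc k) = 0"
| "gbin q (Suc n) (Suc k) = gbin q n k + q ^ Suc k * gbin q n (Suc k)"

definition qdiffs :: "'a::comm_ring_1 \<Rightarrow> nat \<Rightarrow> 'a" where
  "qdiffs q n = (\<Prod>i<n. 1 - q ^ Suc i)"

lemma qdiffs_simps [simp]:
  "qdiffs q 0 = 1" "qdiffs q (Suc n) = qdiffs q n * (1 - q ^ Suc n)"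
  by (simp_all add: qdiffs_def)

lemma gbin_eq_0 [simp]: "n < k \<Longrightarrow> gbin q n k = 0"
proof (induction q n k rule: gbin.induct)
  case (3 q n k)
  then show ?case by simp
qed auto

lemma gbin_self [simp]: "gbin q n n = 1"
  by (induction n) auto

text \<open>The mirror image of the defining rule under k -> n - k. The induction expands one row by
  the defining rule and the next by the hypothesis, then regroups.\<close>

lemma gbin_Suc_Suc_alt:
  "k \<le> n \<Longrightarrow> gbin q (Suc n) (Suc k) = q ^ (n - k) * gbin q n k + gbin q n (Suc k)"
proof (induction n arbitrary: k)
  case 0
  then show ?case by simp
next
  case (Suc n)
  show ?case
  proof (cases k)
    case 0
    have "gbin q (Suc n) (Suc 0) = q ^ n + gbin q n (Suc 0)"
      using Suc.IH[of 0] by simp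
    moreover have "gbin q (Suc n) (Suc 0) = 1 + q * gbin q n (Suc 0)"
      by simp
    ultimately show ?thesis
      using 0 by (simp add: algebra_simps)
  next
    case (Suc k')
    show ?thesis
    proof (cases "k' = n")
      case True
      then show ?thesis using Suc by simp
    next
      case False
      then have "k' < n" using Suc Suc.prems by simp
      then obtain d where d: "n = Suc (k' + d)"
        using less_iff_Suc_add by auto
      have 1: "gbin q (Suc n) (Suc k') = q ^ (n - k') * gbin q n k' + gbin q n (Suc k')"
        using Suc.IH \<open>k' < n\<close> by simp
      have 2: "gbin q (Suc n) (Suc (Suc k')) = q ^ (n - Suc k') * gbin q n (Suc k') + gbin q n (Suc (Suc k'))"
        using Suc.IH[of "Suc k'"] \<open>k' < n\<close> by (simp del: gbin.simps)
      have "gbin q (Suc (Suc n)) (Suc k) =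
          gbin q (Suc n) (Suc k') + q ^ Suc k * gbin q (Suc n) (Suc k)"
        using Suc by simp
      also have "\<dots> = q ^ (n - k') * gbin q n k' + gbin q n (Suc k') +
          q ^ Suc k * (q ^ (n - Suc k') * gbin q n (Suc k') + gbin q n (Suc (Suc k')))"
        using 1 2 Suc by metis
      also have "\<dots> = q ^ (n - k') * (gbin q n k' + q ^ Suc k' * gbin q n (Suc k')) +
          (gbin q n (Suc k') + q ^ Suc (Suc k') * gbin q n (Suc (Suc k')))"
        using Suc d by (simp add: algebra_simps power_add)
      also have "\<dots> = q ^ (Suc n - k) * gbin q (Suc n) k + gbin q (Suc n) (Suc k)"
        using Suc by simp
      finally show ?thesis .
    qed
  qed
qed

text \<open>The quotient formula for Gaussian binomials, cleared of denominators so that it makes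
  sense in any commutative ring; \<open>qdiffs q n\<close> is (q; q)_n.\<close>

lemma gbin_qdiffs: "k \<le> n \<Longrightarrow> gbin q n k * qdiffs q k * qdiffs q (n - k) = qdiffs q n"
proof (induction q n k rule: gbin.induct)
  case (3 q n k)
  show ?case
  proof (cases "k = n")
    case True
    then show ?thesis by simp
  next
    case False
    then have "k < n" using 3 by simp
    then obtain d where d: "n = Suc (k + d)"
      using less_iff_Suc_add by auto
    have 1: "gbin q n k * qdiffs q k * (qdiffs q d * (1 - q ^ Suc d)) = qdiffs q n"
      using 3 d by simp
    have 2: "gbin q n (Suc k) * (qdiffs q k * (1 - q ^ Suc k)) * qdiffs q d = qdiffs q n"
      using 3 d by simp
    have "gbin q (Suc n) (Suc k) * qdiffs q (Suc k) * qdiffs q (Suc n - Suc k) =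
        (gbin q n k * qdiffs q k * (qdiffs q d * (1 - q ^ Suc d))) * (1 - q ^ Suc k) +
        q ^ Suc k * ((gbin q n (Suc k) * (qdiffs q k * (1 - q ^ Suc k)) * qdiffs q d) * (1 - q ^ Suc d))"
      using d by (simp del: power_Suc add: algebra_simps)
    also have "\<dots> = qdiffs q n * ((1 - q ^ Suc k) + q ^ Suc k * (1 - q ^ Suc d))"
      unfolding 1 2 by (simp add: algebra_simps)
    also have "(1 - q ^ Suc k) + q ^ Suc k * (1 - q ^ Suc d) = 1 - q ^ Suc n"
      using d by (simp add: algebra_simps power_add)
    finally show ?thesis by simp
  qed
qed auto

definition not_root_of_unity :: "'a::comm_ring_1 \<Rightarrow> bool" where
  "not_root_of_unity q \<longleftrightarrow> (\<forall>i>0. q ^ i \<noteq> 1)"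

lemma qdiffs_neq_0: "not_root_of_unity q \<Longrightarrow> qdiffs (q::'a::idom) n \<noteq> 0"
  by (metis (lifting) qdiffs_def finite_lessThan not_root_of_unity_def prod_zero_iff
      right_minus_eq zero_less_Suc)

lemma gbin_trinomial:
  fixes q :: "'a::idom"
  assumes "not_root_of_unity q" "k \<le> j" "j \<le> n"
  shows "gbin q n j * gbin q j k = gbin q n k * gbin q (n - k) (j - k)"
proof -
  let ?d = "qdiffs q k * qdiffs q (j - k) * qdiffs q (n - j)"
  have "gbin q n j * gbin q j k * ?d =
      gbin q n j * (gbin q j k * qdiffs q k * qdiffs q (j - k)) * qdiffs q (n - j)"
    by (simp add: algebra_simps)
  also have "\<dots> = qdiffs q n"
    using assms by (simp add: gbin_qdiffs)
  also have "\<dots> = gbin q n k * qdiffs q k *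
      (gbin q (n - k) (j - k) * qdiffs q (j - k) * qdiffs q ((n - k) - (j - k)))"
    using assms gbin_qdiffs[of "j - k" "n - k" q] gbin_qdiffs[of k n q] by simp
  also have "\<dots> = gbin q n k * gbin q (n - k) (j - k) * ?d"
    using assms by (simp add: algebra_simps)
  finally show ?thesis
    using qdiffs_neq_0[OF assms(1)] by simp
qed

text \<open>Pascal's rule summed by parts. Row N + 1 is traded for row N at the price of a new
  summand; this drives the inductions for the two summation formulas that follow, where the new
  summand is the old one with x replaced by x q, up to a factor.\<close>

lemma sum_gbin_Suc:
  fixes q :: "'a::comm_ring_1"
  shows "(\<Sum>j\<le>Suc N. gbin q (Suc N) j * t j) =
    (\<Sum>j\<le>N. gbin q N j * (q ^ j * t j + t (Suc j)))"
proof -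
  have "(\<Sum>j\<le>Suc N. gbin q (Suc N) j * t j) =
      t 0 + (\<Sum>j\<le>N. (gbin q N j + q ^ Suc j * gbin q N (Suc j)) * t (Suc j))"
    by (subst sum.atMost_Suc_shift) simp
  also have "\<dots> = (t 0 + (\<Sum>j\<le>N. gbin q N (Suc j) * (q ^ Suc j * t (Suc j)))) +
      (\<Sum>j\<le>N. gbin q N j * t (Suc j))"
    by (simp add: algebra_simps sum.distrib)
  also have "t 0 + (\<Sum>j\<le>N. gbin q N (Suc j) * (q ^ Suc j * t (Suc j))) =
      (\<Sum>j\<le>Suc N. gbin q N j * (q ^ j * t j))"
    by (subst sum.atMost_Suc_shift) simp
  also have "\<dots> = (\<Sum>j\<le>N. gbin q N j * (q ^ j * t j))"
    by simp
  finally show ?thesis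
    by (simp add: algebra_simps sum.distrib)
qed

lemma q_binomial_theorem:
  fixes q :: "'a::comm_ring_1"
  shows "(\<Sum>j\<le>N. gbin q N j * (\<Prod>i<j. x * q ^ i)) = (\<Prod>i<N. 1 + x * q ^ i)"
proof (induction N arbitrary: x)
  case (Suc N)
  have p: "q ^ j * (\<Prod>i<j. x * q ^ i) = (\<Prod>i<j. (x * q) * q ^ i)" for j x
    by (induction j) (auto simp: algebra_simps)
  have "(\<Sum>j\<le>Suc N. gbin q (Suc N) j * (\<Prod>i<j. x * q ^ i)) =
      (1 + x) * (\<Sum>j\<le>N. gbin q N j * (\<Prod>i<j. (x * q) * q ^ i))"
    unfolding sum_gbin_Suc p prod.lessThan_Suc_shift sum_distrib_left
    by (intro sum.cong) (auto simp: algebra_simps)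
  also have "\<dots> = (\<Prod>i<Suc N. 1 + x * q ^ i)"
    unfolding Suc.IH prod.lessThan_Suc_shift by (simp add: algebra_simps)
  finally show ?case .
qed simp

text \<open>Here \<open>g i\<close> plays the role of \<open>1 / (1 - x q\<^sup>i)\<close> in a ring without division.\<close>

lemma q_durfee_sum:
  fixes q :: "'a::idom"
  assumes "\<And>i. g i * (1 - x * q ^ i) = 1"
  shows "(\<Sum>j\<le>N. gbin q N j * (\<Prod>i<j. x * q ^ (2 * i) * g i)) = (\<Prod>i<N. g i)"
  using assms
proof (induction N arbitrary: x g)
  case (Suc N)
  define h where "h i = g (Suc i)" for i
  have g: "g i * (1 - x * q ^ i) = 1" for i
    by (rule Suc.prems)
  have h: "h i * (1 - (x * q) * q ^ i) = 1" for i
    using Suc.prems[of "Suc i"] by (simp add: h_def algebra_simps)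
  \<comment> \<open>The two terms produced by \<open>sum_gbin_Suc\<close> are g 0 * (1 - x q^j) and
    g 0 * x q^j times one and the same product, the one belonging to x q. They add up to g 0 times
    that product.\<close>
  have p: "q ^ j * (\<Prod>i<j. x * q ^ (2 * i) * g i) =
      g 0 * (1 - x * q ^ j) * (\<Prod>i<j. (x * q) * q ^ (2 * i) * h i)" for j
  proof (induction j)
    case 0
    then show ?case using g[of 0] by simp
  next
    case (Suc j)
    have "q ^ Suc j * (\<Prod>i<Suc j. x * q ^ (2 * i) * g i) =
        (q ^ j * (\<Prod>i<j. x * q ^ (2 * i) * g i)) * (q * (x * q ^ (2 * j) * g j))"
      by (simp add: algebra_simps)
    also have "\<dots> = g 0 * (g j * (1 - x * q ^ j)) *
        (\<Prod>i<j. (x * q) * q ^ (2 * i) * h i) * (x * q * q ^ (2 * j))"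
      unfolding Suc.IH by (simp add: algebra_simps)
    also have "\<dots> = g 0 * (h j * (1 - (x * q) * q ^ j)) *
        (\<Prod>i<j. (x * q) * q ^ (2 * i) * h i) * (x * q * q ^ (2 * j))"
      by (simp only: h g)
    finally show ?case
      by (simp add: algebra_simps)
  qed
  have r: "(\<Prod>i<Suc j. x * q ^ (2 * i) * g i) =
      g 0 * x * q ^ j * (\<Prod>i<j. (x * q) * q ^ (2 * i) * h i)" for j
  proof (induction j)
    case (Suc j)
    have "(\<Prod>i<Suc (Suc j). x * q ^ (2 * i) * g i) =
       (\<Prod>i<Suc j. x * q ^ (2 * i) * g i) * (x * q ^ (2 * Suc j) * g (Suc j))"
      by simp
    then show ?case
      unfolding Suc.IH by (simp add: h_def algebra_simps)
  qed (simp add: algebra_simps)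
  have "(\<Sum>j\<le>Suc N. gbin q (Suc N) j * (\<Prod>i<j. x * q ^ (2 * i) * g i)) =
      (\<Sum>j\<le>N. g 0 * (gbin q N j * (\<Prod>i<j. (x * q) * q ^ (2 * i) * h i)))"
    unfolding sum_gbin_Suc p r by (intro sum.cong) (auto simp: algebra_simps)
  also have "\<dots> = g 0 * (\<Prod>i<N. h i)"
    unfolding sum_distrib_left[symmetric] using Suc.IH[of h "x * q"] h by simp
  also have "\<dots> = (\<Prod>i<Suc N. g i)"
    unfolding prod.lessThan_Suc_shift h_def by simp
  finally show ?case .
qed simp

section \<open>Algebra of lower triangular matrices\<close>

definition mmul :: "(nat \<Rightarrow> nat \<Rightarrow> 'a) \<Rightarrow> (nat \<Rightarrow> nat \<Rightarrow> 'a) \<Rightarrow> nat \<Rightarrow> nat \<Rightarrow> 'a::comm_ring_1" where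
  "mmul A B n k = (\<Sum>j=k..n. A n j * B j k)"

definition mat :: "'a::comm_ring_1 \<Rightarrow> (nat \<Rightarrow> 'a) \<Rightarrow> nat \<Rightarrow> nat \<Rightarrow> 'a" where
  "mat q f n k = gbin q n k * (\<Prod>i=k..<n. f i)"

text \<open>On lower triangular matrices this is conjugation by the diagonal matrix with n-th entry
  w 0 * ... * w (n - 1), written without its inverse. Hence it is compatible with products.\<close>

definition scale :: "(nat \<Rightarrow> 'a) \<Rightarrow> (nat \<Rightarrow> nat \<Rightarrow> 'a) \<Rightarrow> nat \<Rightarrow> nat \<Rightarrow> 'a::comm_ring_1" where
  "scale w A n k = (\<Prod>i=k..<n. w i) * A n k"

lemma mmul_assoc: "mmul (mmul A B) C = mmul A (mmul B C)"
proof (intro ext)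
  fix n k
  have "mmul (mmul A B) C n k = (\<Sum>l=k..n. \<Sum>j=l..n. A n j * B j l * C l k)"
    by (simp add: mmul_def sum_distrib_right)
  also have "\<dots> = (\<Sum>j=k..n. \<Sum>l=k..j. A n j * B j l * C l k)"
    unfolding sum.Sigma[OF finite_atLeastAtMost ballI[OF finite_atLeastAtMost]]
    by (rule sum.reindex_bij_witness[of _ "\<lambda>(x, y). (y, x)" "\<lambda>(x, y). (y, x)"]) auto
  also have "\<dots> = mmul A (mmul B C) n k"
    by (simp add: mmul_def sum_distrib_left algebra_simps)
  finally show "mmul (mmul A B) C n k = mmul A (mmul B C) n k" .
qed

lemma prod_ivl_split:
  fixes k j n :: nat
  shows "k \<le> j \<Longrightarrow> j \<le> n \<Longrightarrow> (\<Prod>i=k..<n. f i) = (\<Prod>i=j..<n. f i) * (\<Prod>i=k..<j. f i)"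
  by (metis mult.commute prod.atLeastLessThan_concat)

lemma scale_mmul: "scale w (mmul A B) = mmul (scale w A) (scale w B)"
proof (intro ext)
  fix n k
  show "scale w (mmul A B) n k = mmul (scale w A) (scale w B) n k"
    unfolding scale_def mmul_def sum_distrib_left
    by (intro sum.cong) (auto simp: prod_ivl_split[of k _ n w] algebra_simps)
qed

lemma scale_mat: "scale w (mat q f) = mat q (\<lambda>i. w i * f i)"
  by (intro ext) (simp add: scale_def mat_def prod.distrib algebra_simps)

lemma scale_scale: "scale v (scale w A) = scale (\<lambda>i. v i * w i) A"
  by (intro ext) (simp add: scale_def prod.distrib algebra_simps)

lemma scale_1 [simp]: "scale (\<lambda>i. 1) A = A"
  by (intro ext) (simp add: scale_def)

lemma prod_ivl_shift:
  fixes k j :: nat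
  shows "(\<Prod>i=k..<k + j. f i) = (\<Prod>i<j. f (k + i))"
  by (induction j) auto

text \<open>By the trinomial identity every summand of the matrix product contains the entry
  \<open>mat q f n k\<close>. What is left is a sum over a single row of Gaussian binomials, so that
  an identity between matrices becomes a summation formula for each column k.\<close>

lemma mmul_mat_factor:
  fixes q :: "'a::idom"
  assumes q: "not_root_of_unity q"
    and B: "\<And>j k. k \<le> j \<Longrightarrow> B j k = mat q f j k * u j k"
  shows "k \<le> n \<Longrightarrow> mmul (mat q f) B n k = mat q f n k * (\<Sum>j\<le>n - k. gbin q (n - k) j * u (k + j) k)"
proof -
  assume kn: "k \<le> n"
  have "mmul (mat q f) B n k = (\<Sum>j=k..n. mat q f n k * (gbin q (n - k) (j - k) * u j k))"
    unfolding mmul_def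
  proof (intro sum.cong refl)
    fix j assume j: "j \<in> {k..n}"
    have "mat q f n j * B j k =
        (gbin q n j * gbin q j k) * ((\<Prod>i=j..<n. f i) * (\<Prod>i=k..<j. f i)) * u j k"
      using j by (simp add: B mat_def algebra_simps)
    also have "\<dots> = mat q f n k * (gbin q (n - k) (j - k) * u j k)"
      using j gbin_trinomial[OF q, of k j n] prod_ivl_split[of k j n f]
      by (simp add: mat_def mult.assoc mult.left_commute)
    finally show "mat q f n j * B j k = mat q f n k * (gbin q (n - k) (j - k) * u j k)" .
  qed
  also have "\<dots> = mat q f n k * (\<Sum>j\<le>n - k. gbin q (n - k) j * u (k + j) k)"
    unfolding sum_distrib_left
    by (rule sum.reindex_bij_witness[of _ "\<lambda>j. j + k" "\<lambda>j. j - k"]) (use kn in auto)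
  finally show ?thesis .
qed

lemma mmul_mat_mat:
  fixes q :: "'a::idom"
  assumes q: "not_root_of_unity q"
  shows "mmul (mat q f) (mat q (\<lambda>i. f i * (x * q ^ i))) = mat q (\<lambda>i. f i * (1 + x * q ^ i))"
proof (intro ext)
  fix n k
  show "mmul (mat q f) (mat q (\<lambda>i. f i * (x * q ^ i))) n k = mat q (\<lambda>i. f i * (1 + x * q ^ i)) n k"
  proof (cases "k \<le> n")
    case True
    have "mmul (mat q f) (mat q (\<lambda>i. f i * (x * q ^ i))) n k =
        mat q f n k * (\<Sum>j\<le>n - k. gbin q (n - k) j * (\<Prod>i=k..<k + j. x * q ^ i))"
      by (rule mmul_mat_factor[OF q _ True]) (simp add: mat_def prod.distrib)
    also have "\<dots> = mat q f n k * (\<Prod>i<n - k. 1 + (x * q ^ k) * q ^ i)"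
      unfolding prod_ivl_shift
      by (subst q_binomial_theorem[symmetric]) (simp add: power_add mult.assoc)
    also have "(\<Prod>i<n - k. 1 + (x * q ^ k) * q ^ i) = (\<Prod>i=k..<n. 1 + x * q ^ i)"
      using prod_ivl_shift[of "\<lambda>i. 1 + x * q ^ i" k "n - k"] True
      by (simp add: power_add mult.assoc)
    also have "mat q f n k * \<dots> = mat q (\<lambda>i. f i * (1 + x * q ^ i)) n k"
      by (simp add: mat_def prod.distrib mult.assoc)
    finally show ?thesis .
  qed (simp add: mmul_def mat_def)
qed

lemma mmul_mat_merge:
  fixes q :: "'a::idom"
  assumes "not_root_of_unity q" and "\<And>i. g i = f i * (x * q ^ i)"
  shows "mmul (mat q f) (mmul (mat q g) R) = mmul (mat q (\<lambda>i. f i * (1 + x * q ^ i))) R"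
  unfolding mmul_assoc[symmetric] mmul_mat_mat[OF assms(1), symmetric]
  using assms(2) by presburger

text \<open>Unlike in a \<open>mat\<close>, the factors \<open>g (k + i)\<close> depend on the
  column k. The denominators 1 - a b c d q^(k + i) of the Askey--Wilson connection coefficients have
  this shape.\<close>

definition tail_mat :: "'a::comm_ring_1 \<Rightarrow> (nat \<Rightarrow> 'a) \<Rightarrow> (nat \<Rightarrow> 'a) \<Rightarrow> nat \<Rightarrow> nat \<Rightarrow> 'a" where
  "tail_mat q g f n k = mat q f n k * (\<Prod>i=k..<n. g (k + i))"

text \<open>The fixed-point equation behind the infinite product of the factors with \<open>t\<^sub>4 > 0\<close>, where
  \<open>w = a\<^sub>1 a\<^sub>2 a\<^sub>3 a\<^sub>4\<close>: raising all four entries of a quadruple by 1 amounts to rescaling its factor.\<close>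

lemma tail_mat_unfold:
  fixes q :: "'a::idom"
  assumes q: "not_root_of_unity q" and g: "\<And>i. g i * (1 - w * q ^ i) = 1"
  shows "tail_mat q g f = mmul (mat q f) (scale (\<lambda>i. w * q ^ (2 * i)) (tail_mat q g f))"
proof (intro ext)
  fix n k
  show "tail_mat q g f n k =
      mmul (mat q f) (scale (\<lambda>i. w * q ^ (2 * i)) (tail_mat q g f)) n k"
  proof (cases "k \<le> n")
    case True
    \<comment> \<open>Shifting the product index by k turns w q^(2 i) into w q^(2 k) q^(2 i) and
      \<open>g (k + i)\<close> into \<open>g (2 * k + i)\<close>, so column k is the case x = w q^(2
      k) of \<open>q_durfee_sum\<close>.\<close>
    define x where "x = w * q ^ (2 * k)"
    have gx: "g (2 * k + i) * (1 - x * q ^ i) = 1" for i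
      using g[of "2 * k + i"] by (simp add: x_def power_add mult.assoc)
    have "mmul (mat q f) (scale (\<lambda>i. w * q ^ (2 * i)) (tail_mat q g f)) n k =
        mat q f n k * (\<Sum>j\<le>n - k. gbin q (n - k) j *
          (\<Prod>i=k..<k + j. w * q ^ (2 * i) * g (k + i)))"
      by (rule mmul_mat_factor[OF q _ True]) (simp add: tail_mat_def scale_def prod.distrib)
    also have "\<dots> = mat q f n k * (\<Prod>i<n - k. g (2 * k + i))"
    proof -
      have "2 * (k + i) = 2 * k + 2 * i" "k + (k + i) = 2 * k + i" for i
        by simp_all
      then have "(\<Prod>i<j. w * q ^ (2 * (k + i)) * g (k + (k + i))) =
          (\<Prod>i<j. x * q ^ (2 * i) * g (2 * k + i))" for j
        by (simp only: x_def power_add mult.assoc)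
      then show ?thesis
        unfolding prod_ivl_shift q_durfee_sum[of "\<lambda>i. g (2 * k + i)" x q, OF gx, symmetric]
        by simp
    qed
    also have "\<dots> = tail_mat q g f n k"
      using prod_ivl_shift[of "\<lambda>i. g (k + i)" k "n - k"] True
      by (simp add: tail_mat_def mult_2 add.assoc)
    finally show ?thesis by simp
  qed (simp add: mmul_def mat_def tail_mat_def)
qed

section \<open>Connection coefficients of Askey--Wilson polynomials\<close>

lemma gbin_lower:
  fixes q :: "'a::comm_ring_1"
  assumes "k \<le> n"
  shows "gbin q n (Suc k) * (1 - q ^ Suc k) = gbin q n k * (1 - q ^ (n - k))"
  using gbin_Suc_Suc_alt[OF assms, of q] by (simp add: algebra_simps)

lemma gbin_absorb:
  fixes q :: "'a::comm_ring_1"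
  shows "gbin q (Suc n) (Suc k) * (1 - q ^ Suc k) = (1 - q ^ Suc n) * gbin q n k"
proof (cases "k \<le> n")
  case True
  have "gbin q (Suc n) (Suc k) * (1 - q ^ Suc k) =
      gbin q n k * (1 - q ^ Suc k) + q ^ Suc k * (gbin q n (Suc k) * (1 - q ^ Suc k))"
    by (simp add: algebra_simps)
  also have "\<dots> = gbin q n k * (1 - q ^ Suc k * q ^ (n - k))"
    unfolding gbin_lower[OF True] by (simp add: algebra_simps)
  also have "q ^ Suc k * q ^ (n - k) = q ^ Suc n"
    using True by (simp del: power_Suc flip: power_add)
  finally show ?thesis by (simp add: mult.commute)
qed simp

lemma gbin_absorb_upper:
  fixes q :: "'a::comm_ring_1"
  assumes "j \<le> Suc n"
  shows "gbin q (Suc n) j * (1 - q ^ (Suc n - j)) = (1 - q ^ Suc n) * gbin q n j"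
proof (cases j)
  case (Suc k)
  then have k: "k \<le> n" using assms by simp
  have "gbin q (Suc n) (Suc k) * (1 - q ^ (n - k)) =
      q ^ (n - k) * (gbin q n k * (1 - q ^ (n - k))) + gbin q n (Suc k) * (1 - q ^ (n - k))"
    unfolding gbin_Suc_Suc_alt[OF k] by (simp add: algebra_simps)
  also have "\<dots> = gbin q n (Suc k) * (1 - q ^ (n - k) * q ^ Suc k)"
    unfolding gbin_lower[OF k, symmetric] by (simp add: algebra_simps)
  also have "q ^ (n - k) * q ^ Suc k = q ^ Suc n"
    using k by (simp del: power_Suc flip: power_add)
  finally show ?thesis using Suc by (simp add: mult.commute)
qed simp

text \<open>Over the common denominator \<open>R\<close>, the product of 1 - u q^e for m \<le> e
  \<le> m + N + 1, the left side lacks e = 2 m + 1 and the two terms on the right lack the top and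
  the bottom exponent. The resulting numerators are linear in u: the constant terms agree by one
  Pascal rule, the coefficients of u by the other.\<close>

lemma gbin_connection_split:
  fixes q u :: "'a::field"
  assumes u: "\<And>i. 1 - u * q ^ i \<noteq> 0"
    and "m \<le> N"
  shows "gbin q (Suc N) (Suc m) /
      ((\<Prod>l=Suc m..<Suc N. 1 - u * q ^ (Suc m + l)) * (\<Prod>l<Suc m. 1 - u * q ^ (m + l))) =
    gbin q N m / (\<Prod>l<Suc N. 1 - u * q ^ (m + l)) +
    q ^ Suc m * gbin q N (Suc m) / (\<Prod>l<Suc N. 1 - u * q ^ (Suc m + l))"
proof -
  define R where "R = (\<Prod>l<Suc (Suc N). 1 - u * q ^ (m + l))"
  let ?D = "(\<Prod>l=Suc m..<Suc N. 1 - u * q ^ (Suc m + l)) * (\<Prod>l<Suc m. 1 - u * q ^ (m + l))"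
  have R1: "R = (\<Prod>l<Suc N. 1 - u * q ^ (m + l)) * (1 - u * q ^ (m + Suc N))"
    by (simp add: R_def)
  have R2: "R = (1 - u * q ^ m) * (\<Prod>l<Suc N. 1 - u * q ^ (Suc m + l))"
    unfolding R_def by (subst prod.lessThan_Suc_shift) simp
  have "R = (\<Prod>l<Suc m. 1 - u * q ^ (m + l)) * (\<Prod>l=Suc m..<Suc (Suc N). 1 - u * q ^ (m + l))"
    unfolding R_def lessThan_atLeast0
    by (rule prod.atLeastLessThan_concat[symmetric]) (use assms in auto)
  also have "(\<Prod>l=Suc m..<Suc (Suc N). 1 - u * q ^ (m + l)) =
      (1 - u * q ^ (m + Suc m)) * (\<Prod>l=Suc m..<Suc N. 1 - u * q ^ (Suc m + l))"
    using assms(2) by (subst prod.atLeast_Suc_lessThan) (simp_all add: prod.atLeast_Suc_lessThan_Suc_shift del: prod.op_ivl_Suc)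
  finally have R3: "R = ?D * (1 - u * q ^ (m + Suc m))"
    by (simp add: mult_ac)
  have R0: "R \<noteq> 0"
    unfolding R_def using u by (simp del: prod.lessThan_Suc)
  have g: "gbin q (Suc N) (Suc m) * (1 - u * q ^ (m + Suc m)) =
      gbin q N m * (1 - u * q ^ (m + Suc N)) + q ^ Suc m * gbin q N (Suc m) * (1 - u * q ^ m)"
  proof -
    have "gbin q (Suc N) (Suc m) * (u * q ^ (m + Suc m)) =
        (q ^ (N - m) * gbin q N m + gbin q N (Suc m)) * (u * q ^ (m + Suc m))"
      by (simp only: gbin_Suc_Suc_alt[OF assms(2)])
    also have "\<dots> = gbin q N m * (u * (q ^ (N - m) * q ^ (m + Suc m))) +
        q ^ Suc m * gbin q N (Suc m) * (u * q ^ m)"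
      by (simp add: algebra_simps power_add)
    also have "q ^ (N - m) * q ^ (m + Suc m) = q ^ (m + Suc N)"
      using assms(2) by (simp add: add.commute flip: power_add)
    finally show ?thesis
      by (simp add: algebra_simps)
  qed
  have frac: "X / Y = X * c / R" if "R = Y * c" for X Y c
    using that R0 by simp
  have frac': "X / Y = X * c / R" if "R = c * Y" for X Y c
    using that R0 by simp
  show ?thesis
    unfolding frac[OF R3] frac[OF R1] frac'[OF R2] g add_divide_distrib ..
qed

text \<open>The splitting above turns the sum for \<open>(N + 1, x)\<close> into the one for \<open>(N, x q)\<close>.\<close>

lemma q_connection_sum:
  fixes q x y :: "'a::field"
  assumes "\<And>i. 1 - x * y * q ^ i \<noteq> 0"
  shows "(\<Sum>i\<le>N. gbin q N i * (\<Prod>l=i..<N. y * (1 - x * q ^ l) / (1 - x * y * q ^ (i + l))) *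
           (\<Prod>l<i. (1 - y * q ^ l) / (1 - x * y * q ^ (i + l - 1)))) = 1"
  using assms
proof (induction N arbitrary: x)
  case (Suc N)
  define u where "u = x * y"
  have u: "1 - u * q ^ i \<noteq> 0" for i
    using Suc.prems by (simp add: u_def)
  define R where "R i = (\<Prod>l<Suc N. 1 - u * q ^ (i + l))" for i
  define V where "V i = (\<Prod>l=i..<Suc N. y * (1 - x * q ^ l))" for i
  define Y where "Y i = (\<Prod>l<i. 1 - y * q ^ l)" for i
  define D where "D i = (\<Prod>l=i..<Suc N. 1 - u * q ^ (i + l)) * (\<Prod>l<i. 1 - u * q ^ (i + l - 1))" for i
  have D0: "gbin q (Suc N) 0 / D 0 = gbin q N 0 / R 0"
    by (simp add: D_def R_def lessThan_atLeast0)
  have DS: "gbin q (Suc N) (Suc m) / D (Suc m) =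
      gbin q N m / R m + q ^ Suc m * gbin q N (Suc m) / R (Suc m)" if "m \<le> N" for m
    using gbin_connection_split[OF u that] by (simp only: D_def R_def add_Suc diff_Suc_1)
  \<comment> \<open>Both terms share \<open>V (Suc i)\<close>, \<open>Y i\<close> and the
    denominator \<open>R i\<close>. The remaining bracket (1 - y q^i) + q^i y (1 - x q^i) collapses
    to 1 - x y q^(2 i), which is precisely the factor of \<open>R i\<close> missing from the
    denominators for x q.\<close>
  have summand: "gbin q N i / R i * V (Suc i) * Y (Suc i) + q ^ i * gbin q N i / R i * V i * Y i =
      gbin q N i * (\<Prod>l=i..<N. y * (1 - (x * q) * q ^ l) / (1 - (x * q) * y * q ^ (i + l))) *
           (\<Prod>l<i. (1 - y * q ^ l) / (1 - (x * q) * y * q ^ (i + l - 1)))" if "i \<le> N" for i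
  proof -
    have V: "V i = y * (1 - x * q ^ i) * V (Suc i)"
      unfolding V_def using that by (subst prod.atLeast_Suc_lessThan) auto
    have V': "V (Suc i) = (\<Prod>l=i..<N. y * (1 - (x * q) * q ^ l))"
      unfolding V_def prod.atLeast_Suc_lessThan_Suc_shift by (simp add: mult.assoc)
    have Y': "Y (Suc i) = (1 - y * q ^ i) * Y i"
      by (simp add: Y_def)
    have "R i = (\<Prod>l<i. 1 - u * q ^ (i + l)) * (\<Prod>l=i..<Suc N. 1 - u * q ^ (i + l))"
      unfolding R_def lessThan_atLeast0
      by (rule prod.atLeastLessThan_concat[symmetric]) (use that in auto)
    also have "(\<Prod>l=i..<Suc N. 1 - u * q ^ (i + l)) =
        (1 - u * q ^ (i + i)) * (\<Prod>l=i..<N. 1 - u * q ^ Suc (i + l))"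
      using that by (subst prod.atLeast_Suc_lessThan)
        (simp_all add: prod.atLeast_Suc_lessThan_Suc_shift del: prod.op_ivl_Suc)
    also have "(\<Prod>l=i..<N. 1 - u * q ^ Suc (i + l)) =
        (\<Prod>l=i..<N. 1 - (x * q) * y * q ^ (i + l))"
      by (simp add: u_def mult_ac)
    also have "(\<Prod>l<i. 1 - u * q ^ (i + l)) = (\<Prod>l<i. 1 - (x * q) * y * q ^ (i + l - 1))"
    proof (intro prod.cong refl)
      fix l assume "l \<in> {..<i}"
      then have "q ^ (i + l) = q * q ^ (i + l - 1)"
        by (metis Suc_diff_1 add_gr_0 gr_zeroI lessThan_iff not_less_zero power_Suc)
      then show "1 - u * q ^ (i + l) = 1 - (x * q) * y * q ^ (i + l - 1)"
        by (simp add: u_def mult_ac)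
    qed
    finally have R': "R i = (1 - u * q ^ (i + i)) * ((\<Prod>l=i..<N. 1 - (x * q) * y * q ^ (i + l)) *
        (\<Prod>l<i. 1 - (x * q) * y * q ^ (i + l - 1)))"
      by (simp only: mult_ac)
    have "gbin q N i / R i * V (Suc i) * Y (Suc i) + q ^ i * gbin q N i / R i * V i * Y i =
        gbin q N i * V (Suc i) * Y i * ((1 - y * q ^ i) + q ^ i * (y * (1 - x * q ^ i))) / R i"
      unfolding V Y' times_divide_eq_left add_divide_distrib[symmetric]
      by (simp add: algebra_simps)
    also have "(1 - y * q ^ i) + q ^ i * (y * (1 - x * q ^ i)) = 1 - u * q ^ (i + i)"
      by (simp add: u_def algebra_simps power_add)
    also have "gbin q N i * V (Suc i) * Y i * (1 - u * q ^ (i + i)) / R i =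
        gbin q N i * V (Suc i) * Y i / ((\<Prod>l=i..<N. 1 - (x * q) * y * q ^ (i + l)) *
        (\<Prod>l<i. 1 - (x * q) * y * q ^ (i + l - 1)))"
      unfolding R' using u[of "i + i"] by simp
    finally show ?thesis
      unfolding V' Y_def by (simp add: prod_dividef)
  qed
  have "(\<Sum>i\<le>Suc N. gbin q (Suc N) i * (\<Prod>l=i..<Suc N. y * (1 - x * q ^ l) / (1 - x * y * q ^ (i + l))) *
           (\<Prod>l<i. (1 - y * q ^ l) / (1 - x * y * q ^ (i + l - 1)))) =
      (\<Sum>i\<le>Suc N. gbin q (Suc N) i / D i * V i * Y i)"
    by (intro sum.cong refl) (simp add: D_def V_def Y_def u_def prod_dividef del: prod.op_ivl_Suc gbin.simps)
  also have "\<dots> = gbin q N 0 / R 0 * V 0 * Y 0 +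
      (\<Sum>m\<le>N. gbin q N m / R m * V (Suc m) * Y (Suc m) +
         q ^ Suc m * gbin q N (Suc m) / R (Suc m) * V (Suc m) * Y (Suc m))"
    by (subst sum.atMost_Suc_shift)
      (simp add: D0 DS distrib_right del: gbin.simps power_Suc)
  also have "\<dots> = (\<Sum>m\<le>N. gbin q N m / R m * V (Suc m) * Y (Suc m)) +
      (\<Sum>i\<le>Suc N. q ^ i * gbin q N i / R i * V i * Y i)"
    by (subst sum.atMost_Suc_shift) (simp add: sum.distrib del: power_Suc)
  also have "\<dots> = (\<Sum>i\<le>N. gbin q N i / R i * V (Suc i) * Y (Suc i) + q ^ i * gbin q N i / R i * V i * Y i)"
    by (simp add: sum.distrib)
  also have "\<dots> = (\<Sum>i\<le>N. gbin q N i * (\<Prod>l=i..<N. y * (1 - (x * q) * q ^ l) / (1 - (x * q) * y * q ^ (i + l))) *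
           (\<Prod>l<i. (1 - y * q ^ l) / (1 - (x * q) * y * q ^ (i + l - 1))))"
    by (intro sum.cong refl summand) simp
  also have "\<dots> = 1"
  proof (rule Suc.IH)
    show "1 - x * q * y * q ^ i \<noteq> 0" for i
      using Suc.prems[of "Suc i"] by (simp add: mult_ac)
  qed
  finally show ?case .
qed simp

section \<open>Expansion in the basis (a z, a / z; q)_j and the adjunction of one parameter\<close>

definition mvec :: "(nat \<Rightarrow> nat \<Rightarrow> 'a) \<Rightarrow> (nat \<Rightarrow> 'a) \<Rightarrow> nat \<Rightarrow> 'a::comm_ring_1" where
  "mvec A v n = (\<Sum>k\<le>n. A n k * v k)"

lemma mvec_mmul: "mvec (mmul A B) v = mvec A (mvec B v)"
proof
  fix n
  \<comment> \<open>A vector is column 0 of a matrix with equal columns, so associativity of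
    \<open>mmul\<close> applies.\<close>
  have "mvec (mmul A B) v n = mmul (mmul A B) (\<lambda>k _. v k) n 0"
    by (simp add: mvec_def mmul_def[of "mmul A B"] atMost_atLeast0)
  also have "\<dots> = mvec A (mvec B v) n"
    by (simp add: mmul_assoc) (simp add: mvec_def mmul_def atMost_atLeast0)
  finally show "mvec (mmul A B) v n = mvec A (mvec B v) n" .
qed

text \<open>The coefficients of \<open>2\<^sup>n p\<^sub>n\<close> in the basis \<open>(a z, a / z; q)\<^sub>j\<close>. The truncated \<open>n - 1\<close> is harmless,
  as the product is empty for \<open>n = 0\<close>.\<close>

definition aw_coeff :: "'a::field \<Rightarrow> 'a \<Rightarrow> 'a \<Rightarrow> 'a \<Rightarrow> 'a \<Rightarrow> nat \<Rightarrow> nat \<Rightarrow> 'a" where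
  "aw_coeff q a b c d n j =
     gbin q n j * ((-1) ^ j * q ^ ((j choose 2) + j)) / (q ^ (n * j) * a ^ n) *
     (\<Prod>i=j..<n. (1 - a * b * q ^ i) * (1 - a * c * q ^ i) * (1 - a * d * q ^ i) /
        (1 - a * b * c * d * q ^ (n - 1 + i)))"

definition aw_basis :: "'a::field \<Rightarrow> 'a \<Rightarrow> 'a \<Rightarrow> nat \<Rightarrow> 'a" where
  "aw_basis q a z j = qpoch (a * z) q j * qpoch (a / z) q j"

text \<open>The matrix of connection coefficients from parameters \<open>(a, b, c, 0)\<close> to \<open>(a, b, c, d)\<close>, up to
  powers of 2.\<close>

definition aw_step :: "'a::field \<Rightarrow> 'a \<Rightarrow> 'a \<Rightarrow> 'a \<Rightarrow> 'a \<Rightarrow> nat \<Rightarrow> nat \<Rightarrow> 'a" where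
  "aw_step q a b c d = tail_mat q (\<lambda>i. 1 / (1 - a * b * c * d * q ^ i))
     (\<lambda>i. d * (1 - a * b * q ^ i) * (1 - a * c * q ^ i) * (1 - b * c * q ^ i))"

text \<open>After the entry of \<open>aw_coeff q a b c 0\<close> is extracted from each summand, the
  rest is \<open>q_connection_sum\<close> with N = n - j, x = b c q^j and y = a d q^j. That sum is a
  limit of the terminating very-well-poised 6phi5 summation with base x y / q, one free parameter
  tending to 0.\<close>

lemma aw_step_coeff:
  fixes q :: "'a::field"
  assumes q: "not_root_of_unity q" "q \<noteq> 0" and a: "a \<noteq> 0"
    and D: "\<And>i. 1 - a * b * c * d * q ^ i \<noteq> 0"
  shows "mmul (aw_step q a b c d) (aw_coeff q a b c d) = aw_coeff q a b c 0"
proof (intro ext)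
  fix n j
  show "mmul (aw_step q a b c d) (aw_coeff q a b c d) n j = aw_coeff q a b c 0 n j"
  proof (cases "j \<le> n")
    case True
    define x where "x = b * c * q ^ j"
    define y where "y = a * d * q ^ j"
    define G where "G k = (\<Prod>i=k..<n. a * d * q ^ j * (1 - b * c * q ^ i) / (1 - a * b * c * d * q ^ (k + i))) *
      (\<Prod>i=j..<k. (1 - a * d * q ^ i) / (1 - a * b * c * d * q ^ (k - 1 + i)))" for k
    have summand: "aw_step q a b c d n k * aw_coeff q a b c d k j =
        aw_coeff q a b c 0 n j * (gbin q (n - j) (k - j) * G k)" if "k \<in> {j..n}" for k
    proof -
      define r where "r = (-1) ^ j * q ^ ((j choose 2) + j)"
      define f where "f i = (1 - a * b * q ^ i) * (1 - a * c * q ^ i)" for i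
      have k: "j \<le> k" "k \<le> n" using that by auto
      have s: "aw_step q a b c d n k = gbin q n k * (d ^ (n - k) * (\<Prod>i=k..<n. f i) *
          (\<Prod>i=k..<n. (1 - b * c * q ^ i) / (1 - a * b * c * d * q ^ (k + i))))"
        by (simp add: aw_step_def tail_mat_def mat_def f_def prod.distrib prod_dividef)
      have c: "aw_coeff q a b c d k j = gbin q k j * r / (q ^ (k * j) * a ^ k) *
          ((\<Prod>i=j..<k. f i) * (\<Prod>i=j..<k. (1 - a * d * q ^ i) / (1 - a * b * c * d * q ^ (k - 1 + i))))"
        by (simp add: aw_coeff_def r_def f_def prod.distrib prod_dividef)
      have c0: "aw_coeff q a b c 0 n j = gbin q n j * r / (q ^ (n * j) * a ^ n) * (\<Prod>i=j..<n. f i)"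
        by (simp add: aw_coeff_def r_def f_def)
      have G: "G k = (a * d * q ^ j) ^ (n - k) *
          (\<Prod>i=k..<n. (1 - b * c * q ^ i) / (1 - a * b * c * d * q ^ (k + i))) *
          (\<Prod>i=j..<k. (1 - a * d * q ^ i) / (1 - a * b * c * d * q ^ (k - 1 + i)))"
        by (simp add: G_def prod.distrib prod_dividef)
      have fp: "(\<Prod>i=j..<n. f i) = (\<Prod>i=k..<n. f i) * (\<Prod>i=j..<k. f i)"
        using k by (rule prod_ivl_split)
      have pw: "d ^ (n - k) / (q ^ (k * j) * a ^ k) = (a * d * q ^ j) ^ (n - k) / (q ^ (n * j) * a ^ n)"
      proof -
        obtain e where e: "n = k + e"
          using k le_Suc_ex by blast
        show ?thesis
          using q(2) a by (simp add: e power_mult_distrib power_add add_mult_distrib divide_simps)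
            (simp add: power_mult[symmetric] mult_ac)
      qed
      have "aw_step q a b c d n k * aw_coeff q a b c d k j =
          (gbin q n k * gbin q k j) * r * (d ^ (n - k) / (q ^ (k * j) * a ^ k)) *
          ((\<Prod>i=k..<n. f i) * (\<Prod>i=j..<k. f i)) *
          (\<Prod>i=k..<n. (1 - b * c * q ^ i) / (1 - a * b * c * d * q ^ (k + i))) *
          (\<Prod>i=j..<k. (1 - a * d * q ^ i) / (1 - a * b * c * d * q ^ (k - 1 + i)))"
        unfolding s c by (simp only: times_divide_eq_left times_divide_eq_right mult_ac)
      also have "\<dots> = aw_coeff q a b c 0 n j * (gbin q (n - j) (k - j) * G k)"
        unfolding pw fp[symmetric] gbin_trinomial[OF q(1) k] c0 G
        by (simp only: times_divide_eq_left times_divide_eq_right mult_ac)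
      finally show ?thesis .
    qed
    have xy: "x * y = a * b * c * d * q ^ (j + j)"
      by (simp add: x_def y_def power_add mult_ac)
    have Gj: "G (j + i) = (\<Prod>l=i..<n - j. y * (1 - x * q ^ l) / (1 - x * y * q ^ (i + l))) *
           (\<Prod>l<i. (1 - y * q ^ l) / (1 - x * y * q ^ (i + l - 1)))" if "i \<le> n - j" for i
    proof -
      have "(\<Prod>k=j + i..<n. a * d * q ^ j * (1 - b * c * q ^ k) / (1 - a * b * c * d * q ^ (j + i + k))) =
          (\<Prod>l=i..<n - j. y * (1 - x * q ^ l) / (1 - x * y * q ^ (i + l)))"
      proof (rule prod.reindex_bij_witness[of _ "\<lambda>l. l + j" "\<lambda>k. k - j"])
        fix k assume "k \<in> {j + i..<n}"
        then obtain l where "k = j + l"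
          by (metis add_leD1 atLeastLessThan_iff le_Suc_ex)
        then show "y * (1 - x * q ^ (k - j)) / (1 - x * y * q ^ (i + (k - j))) =
            a * d * q ^ j * (1 - b * c * q ^ k) / (1 - a * b * c * d * q ^ (j + i + k))"
          unfolding xy by (simp add: x_def y_def power_add mult_ac)
      qed (use that True in auto)
      moreover have "(\<Prod>k=j..<j + i. (1 - a * d * q ^ k) / (1 - a * b * c * d * q ^ (j + i - 1 + k))) =
          (\<Prod>l<i. (1 - y * q ^ l) / (1 - x * y * q ^ (i + l - 1)))"
        unfolding prod_ivl_shift
      proof (intro prod.cong refl)
        fix l assume "l \<in> {..<i}"
        then have "j + i - 1 + (j + l) = j + j + (i + l - 1)"
          by auto
        then have "q ^ (j + i - 1 + (j + l)) = q ^ (j + j) * q ^ (i + l - 1)"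
          by (metis power_add)
        then show "(1 - a * d * q ^ (j + l)) / (1 - a * b * c * d * q ^ (j + i - 1 + (j + l))) =
            (1 - y * q ^ l) / (1 - x * y * q ^ (i + l - 1))"
          unfolding xy by (simp add: y_def power_add mult_ac)
      qed
      ultimately show ?thesis
        unfolding G_def by simp
    qed
    have "mmul (aw_step q a b c d) (aw_coeff q a b c d) n j =
        aw_coeff q a b c 0 n j * (\<Sum>k=j..n. gbin q (n - j) (k - j) * G k)"
      unfolding mmul_def sum_distrib_left by (intro sum.cong summand) auto
    also have "(\<Sum>k=j..n. gbin q (n - j) (k - j) * G k) = (\<Sum>i\<le>n - j. gbin q (n - j) i * G (j + i))"
      by (rule sum.reindex_bij_witness[of _ "\<lambda>i. j + i" "\<lambda>k. k - j"]) (use True in auto)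
    also have "\<dots> = (\<Sum>i\<le>n - j. gbin q (n - j) i *
        (\<Prod>l=i..<n - j. y * (1 - x * q ^ l) / (1 - x * y * q ^ (i + l))) *
        (\<Prod>l<i. (1 - y * q ^ l) / (1 - x * y * q ^ (i + l - 1))))"
      by (intro sum.cong refl) (simp add: Gj mult.assoc)
    also have "\<dots> = 1"
      by (rule q_connection_sum) (use D in \<open>simp add: xy mult.assoc flip: power_add\<close>)
    finally show ?thesis by simp
  qed (simp add: mmul_def aw_coeff_def)
qed

text \<open>Only b, c and d are interchanged, since a is fixed as the base of the expansion. This
  lets \<open>aw_step_coeff\<close>, which adjoins the last parameter, adjoin b and c as
  well.\<close>

lemma aw_coeff_swap:
  "aw_coeff q a b c d = aw_coeff q a c b d" "aw_coeff q a b c d = aw_coeff q a b d c"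
  by (intro ext; simp add: aw_coeff_def mult_ac)+

lemma aw_step_single: "aw_step q a 0 0 d = mat q (\<lambda>_. d)"
  by (intro ext) (simp add: aw_step_def tail_mat_def)

lemma aw_step_pair: "aw_step q a b 0 d = mat q (\<lambda>i. d * (1 - a * b * q ^ i))"
  by (intro ext) (simp add: aw_step_def tail_mat_def)

text \<open>Three applications of \<open>aw_step_coeff\<close> strip d, c and b in this order. In
  the last two, one of the remaining parameters is 0, so the denominators become 1 and
  \<open>aw_step\<close> is a plain \<open>mat\<close>.\<close>

lemma mat_big_hermite_coeff:
  fixes q :: "'a::field"
  assumes q: "not_root_of_unity q" "q \<noteq> 0" and a: "a \<noteq> 0"
    and D: "\<And>i. 1 - a * b * c * d * q ^ i \<noteq> 0"
  shows "mmul (mat q (\<lambda>_. b)) (mmul (mat q (\<lambda>i. c * (1 - a * b * q ^ i)))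
      (mmul (aw_step q a b c d) (aw_coeff q a b c d))) = aw_coeff q a 0 0 0"
proof -
  have "mmul (mat q (\<lambda>i. c * (1 - a * b * q ^ i))) (aw_coeff q a b c 0) = aw_coeff q a b 0 0"
    using aw_step_coeff[OF q a, of b 0 c] by (simp add: aw_step_pair aw_coeff_swap(2)[of _ _ _ c])
  moreover have "mmul (mat q (\<lambda>_. b)) (aw_coeff q a b 0 0) = aw_coeff q a 0 0 0"
    using aw_step_coeff[OF q a, of 0 0 b]
    by (simp add: aw_step_single) (metis aw_coeff_swap)
  ultimately show ?thesis
    using aw_step_coeff[OF q a D] by simp
qed

section \<open>Continuous q-Hermite polynomials, with \<open>hermite_val\<close> the value of 2^n
  H_n, and the introduction of the parameter a\<close>

definition hermite_val :: "'a::field \<Rightarrow> 'a \<Rightarrow> nat \<Rightarrow> 'a" where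
  "hermite_val q z n = (\<Sum>j\<le>n. gbin q n j * (z ^ (n - j) / z ^ j))"

text \<open>At n = 0 the truncated index \<open>n - 1\<close> does no harm, because its coefficient
  1 - q^0 vanishes; a single initial value therefore determines the sequence.\<close>

lemma three_term_unique:
  fixes f g :: "nat \<Rightarrow> 'a::comm_ring_1"
  assumes "\<And>n. f (Suc n) = x * f n - (1 - q ^ n) * f (n - 1)"
    and "\<And>n. g (Suc n) = x * g n - (1 - q ^ n) * g (n - 1)"
    and "f 0 = g 0"
  shows "f n = g n"
proof (induction n rule: less_induct)
  case (less n)
  show ?case
  proof (cases n)
    case (Suc m)
    have "f m = g m" "f (m - 1) = g (m - 1)"
      using less Suc by simp_all
    then show ?thesis
      unfolding Suc assms(1)[of m] assms(2)[of m] by simp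
  qed (use assms(3) in simp)
qed

text \<open>The mirrored Pascal rule gives the terms in 1 / z the weight q^(n - j) = 1 - (1 - q^(n -
  j)). The absorption rule turns the deficit into the term of index n - 1.\<close>

lemma hermite_val_Suc:
  fixes q z :: "'a::field"
  assumes z: "z \<noteq> 0"
  shows "hermite_val q z (Suc n) = (z + 1 / z) * hermite_val q z n - (1 - q ^ n) * hermite_val q z (n - 1)"
proof (cases n)
  case 0
  then show ?thesis using z by (simp add: hermite_val_def)
next
  case (Suc m)
  define p where "p n j = z ^ (n - j) / z ^ j" for n j :: nat
  have p1: "p (Suc n) j = z * p n j" if "j \<le> n" for n j
    using that by (simp add: p_def Suc_diff_le)
  have p2: "p (Suc n) (Suc j) = p n j / z" if "j \<le> n" for n j
    using that by (simp add: p_def)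
  have H: "hermite_val q z n = (\<Sum>j\<le>n. gbin q n j * p n j)" for n
    by (simp add: hermite_val_def p_def)
  have low: "(1 - q ^ n) * hermite_val q z (n - 1) =
      (\<Sum>j\<le>n. gbin q n j * (1 - q ^ (n - j)) * p n j / z)"
  proof -
    have "(\<Sum>j\<le>n. gbin q n j * (1 - q ^ (n - j)) * p n j / z) =
        (\<Sum>j\<le>m. (1 - q ^ Suc m) * gbin q m j * (p n j / z))"
      unfolding Suc sum.atMost_Suc[of _ m]
      using gbin_absorb_upper[of _ m q] by (simp add: mult.assoc del: gbin.simps power_Suc)
    also have "\<dots> = (\<Sum>j\<le>m. (1 - q ^ Suc m) * gbin q m j * p m j)"
      by (intro sum.cong refl) (use z p1[of _ m] Suc in simp)
    finally show ?thesis
      by (simp add: H Suc sum_distrib_left mult.assoc)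
  qed
  have "hermite_val q z (Suc n) =
      p (Suc n) 0 + (\<Sum>j\<le>n. (q ^ (n - j) * gbin q n j + gbin q n (Suc j)) * p (Suc n) (Suc j))"
    unfolding H
    by (subst sum.atMost_Suc_shift) (simp add: gbin_Suc_Suc_alt del: gbin.simps(3))
  also have "\<dots> = (\<Sum>j\<le>n. q ^ (n - j) * gbin q n j * p (Suc n) (Suc j)) +
      (\<Sum>j\<le>Suc n. gbin q n j * p (Suc n) j)"
    by (subst sum.atMost_Suc_shift) (simp add: sum.distrib algebra_simps)
  also have "\<dots> = (\<Sum>j\<le>n. q ^ (n - j) * gbin q n j * (p n j / z)) + (\<Sum>j\<le>n. gbin q n j * (z * p n j))"
    by (simp add: p1 p2)
  also have "\<dots> = (z + 1 / z) * (\<Sum>j\<le>n. gbin q n j * p n j) -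
      (\<Sum>j\<le>n. gbin q n j * (1 - q ^ (n - j)) * p n j / z)"
    unfolding sum_distrib_left sum.distrib[symmetric] sum_subtractf[symmetric]
    by (intro sum.cong refl) (simp add: algebra_simps add_divide_distrib diff_divide_distrib)
  finally show ?thesis
    unfolding low[symmetric] by (simp add: H)
qed

text \<open>For \<open>b = c = d = 0\<close> these are the continuous big q-Hermite polynomials.\<close>

lemma big_hermite_recurrence:
  fixes q a z :: "'a::field"
  assumes q: "q \<noteq> 0" and a: "a \<noteq> 0" and z: "z \<noteq> 0"
  defines "B \<equiv> mvec (aw_coeff q a 0 0 0) (aw_basis q a z)"
  shows "(z + 1 / z) * B n = B (Suc n) + a * q ^ n * B n + (1 - q ^ n) * B (n - 1)"
proof -
  define s where "s j = (-1) ^ j * q ^ ((j choose 2) + j)" for j :: nat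
  define c where "c n j = gbin q n j * s j / (q ^ (n * j) * a ^ n)" for n j :: nat
  define \<phi> where "\<phi> = aw_basis q a z"
  have B: "B n = (\<Sum>j\<le>n. c n j * \<phi> j)" for n
    by (simp add: B_def mvec_def aw_coeff_def c_def s_def \<phi>_def)
  have s: "s (Suc j) = - (q ^ Suc j * s j)" for j
    by (simp add: s_def numeral_2_eq_2 power_add)
  \<comment> \<open>Multiplication by z + 1 / z is bidiagonal in this basis. The terms with 1 / (a
    q^j) build up row n + 1 by means of \<open>up\<close>, and the terms with a q^j split into rows
    n and n - 1 by means of \<open>down\<close>.\<close>
  have \<phi>: "(z + 1 / z) * \<phi> j = (1 / (a * q ^ j) + a * q ^ j) * \<phi> j - \<phi> (Suc j) / (a * q ^ j)" for j
  proof -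
    have "\<phi> (Suc j) = \<phi> j * ((1 - a * z * q ^ j) * (1 - a / z * q ^ j))"
      by (simp add: \<phi>_def aw_basis_def qpoch_def mult_ac)
    also have "(1 - a * z * q ^ j) * (1 - a / z * q ^ j) =
        1 + (a * q ^ j)\<^sup>2 - a * q ^ j * (z + 1 / z)"
      using z by (simp add: field_simps power2_eq_square)
    finally have step: "\<phi> (Suc j) = \<phi> j * (1 + (a * q ^ j)\<^sup>2 - a * q ^ j * (z + 1 / z))" .
    have solve: "x * y = (1 / t + t) * y - y * (1 + t\<^sup>2 - t * x) / t" if "t \<noteq> 0" for x y t :: 'a
      using that by (simp add: field_simps power2_eq_square)
    show ?thesis
      unfolding step by (rule solve) (use a q in simp)
  qed
  have up: "c (Suc n) (Suc j) = c n (Suc j) / (a * q ^ Suc j) - c n j / (a * q ^ j)" if "j \<le> n" for n j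
  proof -
    define P where "P = q ^ (n * j)"
    define Q where "Q = q ^ j"
    define R where "R = q ^ (n - j)"
    have nz: "P \<noteq> 0" "Q \<noteq> 0" "R \<noteq> 0"
      using q by (simp_all add: P_def Q_def R_def)
    have "n * Suc j = n * j + (n - j) + j" "Suc n * Suc j = n * j + (n - j) + j + j + 1"
      using that by simp_all
    then have e: "q ^ (n * Suc j) = P * R * Q" "q ^ (Suc n * Suc j) = P * R * Q * Q * q" "q ^ Suc j = Q * q"
      unfolding P_def Q_def R_def by (simp_all only: power_add power_one_right power_Suc mult_ac)
    show ?thesis
      unfolding c_def gbin_Suc_Suc_alt[OF that] s e power_Suc[of a] Q_def[symmetric]
        R_def[symmetric] P_def[symmetric]
      using q a nz by (simp add: divide_simps) (simp add: algebra_simps)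
  qed
  have up0: "c (Suc n) 0 = c n 0 / a" for n
    by (simp add: c_def s_def)
  have down: "a * q ^ j * c n j = a * q ^ n * c n j + (1 - q ^ n) * c (n - 1) j" if "j \<le> n" for j
  proof (cases n)
    case (Suc m)
    have e: "q ^ j * (1 - q ^ (n - j)) = q ^ j - q ^ n"
      using that by (simp add: right_diff_distrib flip: power_add)
    have "a * q ^ j * c n j - a * q ^ n * c n j = (q ^ j - q ^ n) * (a * c n j)"
      by (simp add: algebra_simps)
    also have "a * c n j = gbin q n j * s j / (q ^ (n * j) * a ^ m)"
      using a by (simp add: c_def Suc)
    also have "(q ^ j - q ^ n) * (gbin q n j * s j / (q ^ (n * j) * a ^ m)) =
        q ^ j * (gbin q n j * (1 - q ^ (n - j))) * s j / (q ^ (n * j) * a ^ m)"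
      unfolding e[symmetric] by (simp only: times_divide_eq_right times_divide_eq_left mult_ac)
    also have "gbin q n j * (1 - q ^ (n - j)) = (1 - q ^ n) * gbin q m j"
      using gbin_absorb_upper[of j m q] that Suc by simp
    also have "q ^ j * ((1 - q ^ n) * gbin q m j) * s j / (q ^ (n * j) * a ^ m) = (1 - q ^ n) * c (n - 1) j"
      using q by (simp add: c_def Suc power_add)
    finally show ?thesis by (simp add: algebra_simps)
  qed (use that in simp)
  have "(z + 1 / z) * B n = (\<Sum>j\<le>n. c n j * ((z + 1 / z) * \<phi> j))"
    by (simp add: B sum_distrib_left mult_ac)
  also have "\<dots> = (\<Sum>j\<le>n. c n j / (a * q ^ j) * \<phi> j) - (\<Sum>j\<le>n. c n j / (a * q ^ j) * \<phi> (Suc j)) +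
      (\<Sum>j\<le>n. a * q ^ j * c n j * \<phi> j)"
    unfolding \<phi> sum.distrib[symmetric] sum_subtractf[symmetric]
    by (intro sum.cong refl) (simp add: algebra_simps)
  also have "(\<Sum>j\<le>n. c n j / (a * q ^ j) * \<phi> j) = (\<Sum>j\<le>Suc n. c n j / (a * q ^ j) * \<phi> j)"
    by (simp add: c_def)
  also have "\<dots> = c n 0 / a * \<phi> 0 + (\<Sum>j\<le>n. c n (Suc j) / (a * q ^ Suc j) * \<phi> (Suc j))"
    by (subst sum.atMost_Suc_shift) simp
  also have "\<dots> - (\<Sum>j\<le>n. c n j / (a * q ^ j) * \<phi> (Suc j)) =
      c (Suc n) 0 * \<phi> 0 + (\<Sum>j\<le>n. c (Suc n) (Suc j) * \<phi> (Suc j))"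
    by (simp add: up up0 sum_subtractf algebra_simps)
  also have "\<dots> = B (Suc n)"
    unfolding B by (subst sum.atMost_Suc_shift) simp
  also have "(\<Sum>j\<le>n. a * q ^ j * c n j * \<phi> j) =
      a * q ^ n * B n + (1 - q ^ n) * (\<Sum>j\<le>n. c (n - 1) j * \<phi> j)"
    unfolding B sum_distrib_left sum.distrib[symmetric]
  proof (intro sum.cong refl)
    fix j assume "j \<in> {..n}"
    then have "a * q ^ j * c n j * \<phi> j = (a * q ^ n * c n j + (1 - q ^ n) * c (n - 1) j) * \<phi> j"
      by (simp only: down atMost_iff)
    then show "a * q ^ j * c n j * \<phi> j = a * q ^ n * (c n j * \<phi> j) + (1 - q ^ n) * (c (n - 1) j * \<phi> j)"
      by (simp only: distrib_right mult.assoc)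
  qed
  also have "(1 - q ^ n) * (\<Sum>j\<le>n. c (n - 1) j * \<phi> j) = (1 - q ^ n) * B (n - 1)"
    by (cases n) (simp_all add: B, simp add: c_def)
  finally show ?thesis by (simp add: add.assoc)
qed

text \<open>The recurrence of the big q-Hermite polynomials is carried through the sum: its term a
  q^k B k completes the shifted sum to row n + 1 by Pascal's rule, and its term (1 - q^k) B (k - 1)
  becomes (1 - q^n) times row n - 1 by absorption. This is the recurrence of
  \<open>hermite_val\<close>.\<close>

lemma hermite_expansion:
  fixes q a z :: "'a::field"
  assumes q: "q \<noteq> 0" and a: "a \<noteq> 0" and z: "z \<noteq> 0"
  shows "mvec (mat q (\<lambda>_. a)) (mvec (aw_coeff q a 0 0 0) (aw_basis q a z)) n = hermite_val q z n"
proof -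
  define B where "B = mvec (aw_coeff q a 0 0 0) (aw_basis q a z)"
  define G where "G = mvec (mat q (\<lambda>_. a)) B"
  have rec: "(z + 1 / z) * B n = B (Suc n) + a * q ^ n * B n + (1 - q ^ n) * B (n - 1)" for n
    unfolding B_def by (rule big_hermite_recurrence[OF q a z])
  have G: "G n = (\<Sum>k\<le>n. gbin q n k * a ^ (n - k) * B k)" for n
    by (simp add: G_def mvec_def mat_def)
  have "G (Suc n) = (z + 1 / z) * G n - (1 - q ^ n) * G (n - 1)" for n
  proof -
    have t1: "(\<Sum>k\<le>n. gbin q n k * a ^ (n - k) * B (Suc k)) +
        (\<Sum>k\<le>n. gbin q n k * a ^ (n - k) * (a * q ^ k * B k)) = G (Suc n)"
    proof -
      have "(\<Sum>k\<le>n. gbin q n k * a ^ (n - k) * (a * q ^ k * B k)) =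
          (\<Sum>k\<le>n. q ^ k * gbin q n k * a ^ (Suc n - k) * B k)"
        by (intro sum.cong refl) (simp add: Suc_diff_le)
      also have "\<dots> = (\<Sum>k\<le>Suc n. q ^ k * gbin q n k * a ^ (Suc n - k) * B k)"
        by simp
      also have "\<dots> = a ^ Suc n * B 0 + (\<Sum>k\<le>n. q ^ Suc k * gbin q n (Suc k) * a ^ (n - k) * B (Suc k))"
        by (subst sum.atMost_Suc_shift) simp
      finally show ?thesis
        unfolding G by (subst sum.atMost_Suc_shift) (simp add: sum.distrib algebra_simps)
    qed
    have t2: "(\<Sum>k\<le>n. gbin q n k * a ^ (n - k) * ((1 - q ^ k) * B (k - 1))) = (1 - q ^ n) * G (n - 1)"
    proof (cases n)
      case (Suc m)
      have "(\<Sum>k\<le>n. gbin q n k * a ^ (n - k) * ((1 - q ^ k) * B (k - 1))) =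
          (\<Sum>k\<le>m. (gbin q (Suc m) (Suc k) * (1 - q ^ Suc k)) * a ^ (m - k) * B k)"
        unfolding Suc by (subst sum.atMost_Suc_shift) (simp add: mult_ac del: gbin.simps power_Suc)
      also have "\<dots> = (1 - q ^ n) * G (n - 1)"
        unfolding gbin_absorb by (simp add: G Suc sum_distrib_left mult_ac)
      finally show ?thesis .
    qed simp
    have "(z + 1 / z) * G n = (\<Sum>k\<le>n. gbin q n k * a ^ (n - k) * ((z + 1 / z) * B k))"
      by (simp add: G sum_distrib_left mult_ac)
    also have "\<dots> = G (Suc n) + (1 - q ^ n) * G (n - 1)"
      unfolding rec distrib_left sum.distrib t1 t2 ..
    finally show ?thesis by simp
  qed
  moreover have "G 0 = hermite_val q z 0"
    by (simp add: G_def mvec_def mat_def B_def aw_coeff_def aw_basis_def qpoch_def hermite_val_def numeral_2_eq_2)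
  ultimately have "G n = hermite_val q z n"
    using three_term_unique[of G "z + 1 / z" q "hermite_val q z" n] hermite_val_Suc[OF z] by blast
  then show ?thesis by (simp add: G_def B_def)
qed

lemma hermite_aw_connection:
  fixes q :: "'a::field"
  assumes q: "not_root_of_unity q" "q \<noteq> 0" and a: "a \<noteq> 0" and z: "z \<noteq> 0"
    and D: "\<And>i. 1 - a * b * c * d * q ^ i \<noteq> 0"
  shows "mvec (mmul (mat q (\<lambda>_. a)) (mmul (mat q (\<lambda>_. b)) (mmul (mat q (\<lambda>i. c * (1 - a * b * q ^ i)))
      (aw_step q a b c d)))) (mvec (aw_coeff q a b c d) (aw_basis q a z)) n = hermite_val q z n"
  unfolding hermite_expansion[OF q(2) a z, symmetric] mat_big_hermite_coeff[OF q a D, symmetric]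
    mvec_mmul ..

section \<open>Polynomials determined by their values at cos theta, and uniqueness of the
  expansion\<close>

lemma poly_of_cos_eqI:
  fixes p :: "'a::field poly"
  assumes q: "not_root_of_unity (q::'a)" "q \<noteq> 0" and two: "(2::'a) \<noteq> 0"
    and p: "\<And>z. z \<noteq> 0 \<Longrightarrow> poly p ((z + 1 / z) / 2) = f z"
  shows "poly_of_cos f = p"
  unfolding poly_of_cos_def
proof (rule the_equality)
  show "\<forall>z. z \<noteq> 0 \<longrightarrow> poly p ((z + 1 / z) / 2) = f z"
    using p by blast
next
  fix p' assume p': "\<forall>z. z \<noteq> 0 \<longrightarrow> poly p' ((z + 1 / z) / 2) = f z"
  \<comment> \<open>These are the points x belonging to z = q^m. Two of them coincide only if q^m =
    q^n or q^(m + n) = 1, which is excluded for m < n; so two candidates agree at infinitely many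
    points.\<close>
  define h where "h m = (q ^ m + 1 / q ^ m) / 2" for m :: nat
  have inj: "h m \<noteq> h n" if "m < n" for m n
  proof
    assume "h m = h n"
    then have "q ^ m + 1 / q ^ m = q ^ n + 1 / q ^ n"
      using two unfolding h_def divide_cancel_right by simp
    then have "q ^ m * q ^ n * (q ^ m + 1 / q ^ m) = q ^ m * q ^ n * (q ^ n + 1 / q ^ n)"
      by simp
    then have "(q ^ n - q ^ m) * (q ^ m * q ^ n - 1) = 0"
      using q(2) by (simp add: algebra_simps)
    moreover have "q ^ m * q ^ n \<noteq> 1"
      using q(1) that unfolding not_root_of_unity_def power_add[symmetric] by simp
    moreover have "q ^ n = q ^ m * q ^ (n - m)"
      using that by (simp flip: power_add)
    moreover have "q ^ (n - m) \<noteq> 1"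
      using q(1) that unfolding not_root_of_unity_def by simp
    ultimately show False
      using q(2) by simp
  qed
  have "inj h"
    by (rule injI) (metis inj nat_neq_iff)
  then have "infinite (range h)"
    using finite_imageD infinite_UNIV_nat by blast
  moreover have "range h \<subseteq> {x. poly (p' - p) x = 0}"
    using p p' q(2) by (auto simp: h_def)
  ultimately have "infinite {x. poly (p' - p) x = 0}"
    using finite_subset by blast
  then have "p' - p = 0"
    using poly_roots_finite[of "p' - p"] by argo
  then show "p' = p" by simp
qed

text \<open>The linear factors are (1 - a z q^i) (1 - a q^i / z) rewritten in x = (z + 1 / z) /
  2.\<close>

definition aw_poly :: "'a::field \<Rightarrow> 'a \<Rightarrow> 'a \<Rightarrow> 'a \<Rightarrow> 'a \<Rightarrow> nat \<Rightarrow> 'a poly" where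
  "aw_poly q a b c d n = (\<Sum>j\<le>n. smult (aw_coeff q a b c d n j / 2 ^ n)
     (\<Prod>i<j. [:1 + (a * q ^ i)\<^sup>2, - 2 * (a * q ^ i):]))"

lemma poly_aw_poly:
  assumes z: "z \<noteq> 0" and two: "(2::'a::field) \<noteq> 0"
  shows "poly (aw_poly q a b c d n) ((z + 1 / z) / 2) =
    mvec (aw_coeff q a b c d) (aw_basis q a z) n / (2::'a) ^ n"
proof -
  have "1 + (a * q ^ i)\<^sup>2 + (z + 1 / z) / 2 * (- 2 * (a * q ^ i)) =
      (1 - a * z * q ^ i) * (1 - a / z * q ^ i)" for i
    using z two by (simp add: field_simps power2_eq_square)
  then have "(\<Prod>i<j. poly [:1 + (a * q ^ i)\<^sup>2, - 2 * (a * q ^ i):] ((z + 1 / z) / 2)) = aw_basis q a z j" for j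
    unfolding aw_basis_def qpoch_def prod.distrib[symmetric] by (intro prod.cong) simp_all
  then show ?thesis
    unfolding aw_poly_def mvec_def poly_sum poly_smult poly_prod sum_divide_distrib by simp
qed

text \<open>Needed for the uniqueness of the expansion coefficients. The product in the diagonal
  entry of \<open>aw_coeff\<close> is empty, so the leading coefficient is nonzero whatever b, c and
  d are.\<close>

lemma degree_aw_poly:
  fixes q a :: "'a::field"
  assumes "not_root_of_unity q" "q \<noteq> 0" "a \<noteq> 0" and two: "(2::'a) \<noteq> 0"
  shows "degree (aw_poly q a b c d n) = n" "aw_poly q a b c d n \<noteq> 0"
proof -
  define g where "g j = (\<Prod>i<j. [:1 + (a * q ^ i)\<^sup>2, - 2 * (a * q ^ i):])" for j
  have nz: "[:1 + (a * q ^ i)\<^sup>2, - 2 * (a * q ^ i):] \<noteq> 0" for i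
    using assms by simp
  have dg: "degree (g j) = j" for j
  proof -
    have "degree (g j) = (\<Sum>i<j. degree [:1 + (a * q ^ i)\<^sup>2, - 2 * (a * q ^ i):])"
      unfolding g_def using nz by (intro degree_prod_eq_sum_degree) blast
    then show ?thesis using assms by simp
  qed
  have g0: "g j \<noteq> 0" for j
    unfolding g_def prod_zero_iff[OF finite_lessThan] using nz by blast
  have "coeff (aw_poly q a b c d n) n = (\<Sum>j\<le>n. aw_coeff q a b c d n j / 2 ^ n * coeff (g j) n)"
    by (simp add: aw_poly_def g_def coeff_sum)
  also have "\<dots> = (\<Sum>j\<in>{n}. aw_coeff q a b c d n j / 2 ^ n * coeff (g j) n)"
    by (rule sum.mono_neutral_right) (auto intro!: coeff_eq_0 simp: dg)
  also have "\<dots> = aw_coeff q a b c d n n / 2 ^ n * lead_coeff (g n)"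
    by (simp add: dg)
  also have "\<dots> \<noteq> 0"
    using assms g0 by (simp add: aw_coeff_def)
  finally have nz': "coeff (aw_poly q a b c d n) n \<noteq> 0" .
  moreover have "degree (aw_poly q a b c d n) \<le> n"
    unfolding aw_poly_def g_def[symmetric]
    by (rule degree_sum_le) (auto intro!: order.trans[OF degree_smult_le] simp: dg)
  ultimately show "degree (aw_poly q a b c d n) = n"
    using le_degree by (metis order_antisym)
  show "aw_poly q a b c d n \<noteq> 0"
    using nz' by auto
qed

lemma qpoch_Suc: "qpoch x q (Suc k) = qpoch x q k * (1 - x * q ^ k)"
  by (simp add: qpoch_def)

lemma qpoch_neq_0: "(\<And>i. 1 - x * q ^ i \<noteq> 0) \<Longrightarrow> qpoch x q k \<noteq> 0"
  by (simp add: qpoch_def)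

lemma qpoch_quotient:
  assumes "\<And>i. 1 - x * q ^ i \<noteq> 0" "k \<le> n"
  shows "qpoch x q n / qpoch x q k = (\<Prod>i=k..<n. 1 - x * q ^ i)"
proof -
  have "qpoch x q n = (\<Prod>i=k..<n. 1 - x * q ^ i) * qpoch x q k"
    unfolding qpoch_def lessThan_atLeast0 using assms by (intro prod_ivl_split) auto
  then show ?thesis
    using qpoch_neq_0[OF assms(1)] by simp
qed

lemma qpoch_q_neg:
  fixes q :: "'a::field"
  assumes q: "not_root_of_unity q" "q \<noteq> 0"
  shows "k \<le> n \<Longrightarrow> qpoch (q powi (- int n)) q k / qpoch q q k =
    gbin q n k * ((-1) ^ k * q ^ (k choose 2)) / q ^ (n * k)"
proof (induction k)
  case 0
  then show ?case by (simp add: qpoch_def numeral_2_eq_2)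
next
  case (Suc k)
  have 1: "1 - q powi (- int n) * q ^ k = (- 1) * ((1 - q ^ (n - k)) * q ^ k / q ^ n)"
  proof -
    have "q ^ n = q ^ (n - k) * q ^ k"
      using Suc.prems by (simp flip: power_add)
    then show ?thesis
      using q(2) by (simp add: power_int_minus field_simps)
  qed
  have 2: "(1 - q ^ (n - k)) * gbin q n k = gbin q n (Suc k) * (1 - q ^ Suc k)"
    using gbin_lower[of k n q] Suc.prems by (simp add: mult.commute)
  have 3: "1 - q ^ Suc k \<noteq> 0"
    using q(1) by (metis not_root_of_unity_def right_minus_eq zero_less_Suc)
  have "qpoch (q powi (- int n)) q (Suc k) / qpoch q q (Suc k) =
      (qpoch (q powi (- int n)) q k / qpoch q q k) * ((1 - q powi (- int n) * q ^ k) / (1 - q ^ Suc k))"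
    by (simp add: qpoch_Suc)
  also have "\<dots> = ((1 - q ^ (n - k)) * gbin q n k) * ((-1) ^ Suc k * q ^ (k choose 2) * q ^ k) /
      (q ^ (n * k) * q ^ n * (1 - q ^ Suc k))"
    unfolding 1 Suc.IH[OF Suc_leD[OF Suc.prems]]
    by (simp only: times_divide_times_eq times_divide_eq_right times_divide_eq_left
        divide_divide_eq_left power_Suc mult_ac)
  also have "\<dots> = gbin q n (Suc k) * ((-1) ^ Suc k * q ^ (Suc k choose 2)) / q ^ (n * Suc k)"
    unfolding 2 using 3 by (simp add: numeral_2_eq_2 power_add mult_ac del: power_Suc)
  finally show ?case .
qed

lemma qpoch_q_neg_eq_0:
  fixes q :: "'a::field"
  assumes "q \<noteq> 0" "n < k"
  shows "qpoch (q powi (- int n)) q k = 0"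
  unfolding qpoch_def using assms
  by (auto intro!: prod_zero bexI[of _ n] simp: power_int_minus)

lemma phi_terminating:
  assumes "\<And>k. n < k \<Longrightarrow> phi_term as bs q z k = 0"
  shows "phi as bs q z = (\<Sum>k\<le>n. phi_term as bs q z k)"
  unfolding phi_def using assms by (intro sum.mono_neutral_left) (auto, meson not_le)

lemma q_hermite_val:
  fixes q z :: "'a::field"
  assumes q: "not_root_of_unity q" "q \<noteq> 0" and z: "z \<noteq> 0"
  shows "z ^ n / 2 ^ n * phi [q powi (- int n), 0] [] q (q ^ n * z powi (- 2)) =
    hermite_val q z n / 2 ^ n"
proof -
  have e: "(q ^ n * z powi (- 2)) ^ k = q ^ (n * k) / z ^ (2 * k)" for k
    by (simp add: power_int_minus power_mult_distrib power_mult power_inverse divide_inverse)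
  have t: "phi_term [q powi (- int n), 0] [] q (q ^ n * z powi (- 2)) k = gbin q n k / z ^ (2 * k)"
    if "k \<le> n" for k
  proof -
    \<comment> \<open>For a 2phi0 series the exponent 1 + s - r is -1, so the factor (-1)^k q^(k
      choose 2) of \<open>phi_term\<close> stands in the denominator and cancels the one coming from
      \<open>qpoch_q_neg\<close>.\<close>
    have "phi_term [q powi (- int n), 0] [] q (q ^ n * z powi (- 2)) k =
        (qpoch (q powi (- int n)) q k / qpoch q q k) / ((-1) ^ k * q ^ (k choose 2)) *
        (q ^ (n * k) / z ^ (2 * k))"
      unfolding phi_term_def e
      by (simp add: qpochs_def qpoch_def[of 0] power_int_minus divide_inverse)
    also have "\<dots> = gbin q n k / z ^ (2 * k)"
      unfolding qpoch_q_neg[OF q that] using q(2) by simp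
    finally show ?thesis .
  qed
  have "phi [q powi (- int n), 0] [] q (q ^ n * z powi (- 2)) = (\<Sum>k\<le>n. gbin q n k / z ^ (2 * k))"
    by (subst phi_terminating[of n])
      (simp_all add: t, simp add: phi_term_def qpochs_def qpoch_q_neg_eq_0[OF q(2)])
  also have "z ^ n * \<dots> = hermite_val q z n"
    unfolding hermite_val_def sum_distrib_left
  proof (intro sum.cong refl)
    fix k assume "k \<in> {..n}"
    then have "z ^ n = z ^ (n - k) * z ^ k"
      by (simp flip: power_add)
    then show "z ^ n * (gbin q n k / z ^ (2 * k)) = gbin q n k * (z ^ (n - k) / z ^ k)"
      using z by (simp add: mult_2 power_add)
  qed
  finally show ?thesis by simp
qed

lemma askey_wilson_val:
  fixes q z :: "'a::field"
  assumes q: "not_root_of_unity q" "q \<noteq> 0"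
    and ab: "\<And>i. 1 - a * b * q ^ i \<noteq> 0" and ac: "\<And>i. 1 - a * c * q ^ i \<noteq> 0"
    and ad: "\<And>i. 1 - a * d * q ^ i \<noteq> 0" and D: "\<And>i. 1 - a * b * c * d * q ^ i \<noteq> 0"
  shows "qpochs [a * b, a * c, a * d] q n
       / (2 ^ n * a ^ n * qpoch (a * b * c * d * q powi (int n - 1)) q n)
     * phi [q powi (- int n), a * b * c * d * q powi (int n - 1), a * z, a / z]
           [a * b, a * c, a * d] q q = mvec (aw_coeff q a b c d) (aw_basis q a z) n / 2 ^ n"
proof -
  define E where "E = a * b * c * d * q powi (int n - 1)"
  have Ed: "qpoch E q k / qpoch E q n = 1 / (\<Prod>i=k..<n. 1 - a * b * c * d * q ^ (n - 1 + i))"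
    if "k \<le> n" for k
  \<comment> \<open>For n = 0 the constant \<open>E\<close> contains q^(-1), whereas the natural
    number \<open>n - 1\<close> is 0; both products are empty then.\<close>
  proof (cases n)
    case 0
    then show ?thesis using that by (simp add: qpoch_def)
  next
    case (Suc m)
    have E: "E = a * b * c * d * q ^ m"
      by (simp add: E_def Suc)
    have nz: "1 - E * q ^ i \<noteq> 0" for i
      using D[of "m + i"] by (simp add: E power_add mult.assoc)
    have "qpoch E q n / qpoch E q k = (\<Prod>i=k..<n. 1 - a * b * c * d * q ^ (n - 1 + i))"
      unfolding qpoch_quotient[OF nz that] by (simp add: E Suc power_add mult.assoc)
    then show ?thesis
      by (metis div_by_1 divide_divide_eq_right mult_1)
  qed
  have t: "qpochs [a * b, a * c, a * d] q n / (a ^ n * qpoch E q n) *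
      phi_term [q powi (- int n), E, a * z, a / z] [a * b, a * c, a * d] q q k =
      aw_coeff q a b c d n k * aw_basis q a z k" if k: "k \<le> n" for k
  proof -
    have "qpochs [a * b, a * c, a * d] q n / (a ^ n * qpoch E q n) *
      phi_term [q powi (- int n), E, a * z, a / z] [a * b, a * c, a * d] q q k =
      (qpoch (q powi (- int n)) q k / qpoch q q k) * q ^ k / a ^ n *
      ((qpoch (a * b) q n / qpoch (a * b) q k) * (qpoch (a * c) q n / qpoch (a * c) q k) *
       (qpoch (a * d) q n / qpoch (a * d) q k) * (qpoch E q k / qpoch E q n)) * aw_basis q a z k"
      by (simp add: phi_term_def qpochs_def aw_basis_def mult_ac)
    also have "\<dots> = aw_coeff q a b c d n k * aw_basis q a z k"
      unfolding qpoch_q_neg[OF q k] qpoch_quotient[OF ab k] qpoch_quotient[OF ac k]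
        qpoch_quotient[OF ad k] Ed[OF k] aw_coeff_def
      by (simp add: prod.distrib prod_dividef power_add mult_ac)
    finally show ?thesis .
  qed
  have "phi [q powi (- int n), E, a * z, a / z] [a * b, a * c, a * d] q q =
      (\<Sum>k\<le>n. phi_term [q powi (- int n), E, a * z, a / z] [a * b, a * c, a * d] q q k)"
    by (rule phi_terminating) (simp add: phi_term_def qpochs_def qpoch_q_neg_eq_0[OF q(2)])
  moreover have rearrange: "X / (t * u * v) * P = X / (u * v) * P / t" for X t u v P :: 'a
    by (simp add: mult_ac)
  ultimately have "qpochs [a * b, a * c, a * d] q n / (a ^ n * qpoch E q n) *
      phi [q powi (- int n), E, a * z, a / z] [a * b, a * c, a * d] q q =
      mvec (aw_coeff q a b c d) (aw_basis q a z) n"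
    by (simp only: sum_distrib_left mvec_def) (intro sum.cong refl t, simp)
  then show ?thesis
    unfolding E_def[symmetric] rearrange by (simp only:)
qed

lemma graded_basis_unique:
  fixes p :: "nat \<Rightarrow> 'a::field poly"
  assumes deg: "\<And>j. degree (p j) = j" and nz: "\<And>j. p j \<noteq> 0"
    and eq: "(\<Sum>j\<le>n. smult (s j) (p j)) = (\<Sum>j\<le>n. smult (t j) (p j))"
    and "j \<le> n"
  shows "s j = t j"
  using eq \<open>j \<le> n\<close>
proof (induction n)
  case 0
  then have "smult (s 0 - t 0) (p 0) = 0"
    by (simp add: smult_diff_left)
  then show ?case using nz 0 by simp
next
  case (Suc n)
  have c: "coeff (\<Sum>j\<le>Suc n. smult (r j) (p j)) (Suc n) = r (Suc n) * coeff (p (Suc n)) (Suc n)" for r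
  proof -
    have "coeff (\<Sum>j\<le>n. smult (r j) (p j)) (Suc n) = 0"
      unfolding coeff_sum coeff_smult by (rule sum.neutral) (simp add: coeff_eq_0 deg)
    then show ?thesis by simp
  qed
  have "coeff (p (Suc n)) (Suc n) \<noteq> 0"
    using nz[of "Suc n"] deg[of "Suc n"] leading_coeff_neq_0 by metis
  then have top: "s (Suc n) = t (Suc n)"
    using c[of s] c[of t] unfolding Suc.prems(1) by simp
  then have "(\<Sum>j\<le>n. smult (s j) (p j)) = (\<Sum>j\<le>n. smult (t j) (p j))"
    using Suc.prems(1) by simp
  then show ?case
    using Suc.IH Suc.prems(2) top le_Suc_eq by blast
qed

theorem sigma_AW_H_eq:
  fixes q :: "'a::field"
  assumes q: "not_root_of_unity q" "q \<noteq> 0" and a: "a \<noteq> 0" and two: "(2::'a) \<noteq> 0"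
    and ab: "\<And>i. 1 - a * b * q ^ i \<noteq> 0" and ac: "\<And>i. 1 - a * c * q ^ i \<noteq> 0"
    and ad: "\<And>i. 1 - a * d * q ^ i \<noteq> 0" and D: "\<And>i. 1 - a * b * c * d * q ^ i \<noteq> 0"
    and kn: "k \<le> n"
  shows "sigma_AW_H n k a b c d q =
    mmul (mat q (\<lambda>_. a)) (mmul (mat q (\<lambda>_. b)) (mmul (mat q (\<lambda>i. c * (1 - a * b * q ^ i)))
      (aw_step q a b c d))) n k / 2 ^ (n - k)"
proof -
  define \<tau> where "\<tau> = mmul (mat q (\<lambda>_. a)) (mmul (mat q (\<lambda>_. b)) (mmul (mat q (\<lambda>i. c * (1 - a * b * q ^ i)))
      (aw_step q a b c d)))"
  \<comment> \<open>The power of 2 balances 2^(-n) in the q-Hermite polynomial against 2^(-j) in the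
    Askey--Wilson polynomial. The value 0 beyond n is forced by the description in
    \<open>sigma_AW_H\<close>.\<close>
  define s where "s j = (if j \<le> n then \<tau> n j / 2 ^ (n - j) else 0)" for j
  have aw: "askey_wilson j a b c d q = aw_poly q a b c d j" for j
    unfolding askey_wilson_def
    unfolding askey_wilson_val[OF q ab ac ad D]
    by (intro poly_of_cos_eqI[OF q two] poly_aw_poly two)
  have h: "q_hermite n q = (\<Sum>j\<le>n. smult (s j) (aw_poly q a b c d j))"
    unfolding q_hermite_def
  proof (rule poly_of_cos_eqI[OF q two])
    fix z :: 'a assume z: "z \<noteq> 0"
    define v where "v = mvec (aw_coeff q a b c d) (aw_basis q a z)"
    have "poly (\<Sum>j\<le>n. smult (s j) (aw_poly q a b c d j)) ((z + 1 / z) / 2) = (\<Sum>j\<le>n. \<tau> n j * v j / 2 ^ n)"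
      unfolding poly_sum poly_smult poly_aw_poly[OF z two] v_def[symmetric]
    proof (intro sum.cong refl)
      fix j assume "j \<in> {..n}"
      then have "(2::'a) ^ n = 2 ^ (n - j) * 2 ^ j" "j \<le> n"
        by (simp_all flip: power_add)
      then show "s j * (v j / 2 ^ j) = \<tau> n j * v j / 2 ^ n"
        by (simp add: s_def)
    qed
    also have "\<dots> = hermite_val q z n / 2 ^ n"
      using hermite_aw_connection[OF q a z D, of n, folded \<tau>_def v_def]
      unfolding mvec_def sum_divide_distrib[symmetric] by simp
    finally show "poly (\<Sum>j\<le>n. smult (s j) (aw_poly q a b c d j)) ((z + 1 / z) / 2) =
        z ^ n / 2 ^ n * phi [q powi (- int n), 0] [] q (q ^ n * z powi (- 2))"
      unfolding q_hermite_val[OF q z] .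
  qed
  have "(THE s :: nat \<Rightarrow> 'a.
        q_hermite n q = (\<Sum>j\<le>n. smult (s j) (askey_wilson j a b c d q)) \<and> (\<forall>j>n. s j = 0)) = s"
  proof (rule the_equality)
    show "q_hermite n q = (\<Sum>j\<le>n. smult (s j) (askey_wilson j a b c d q)) \<and> (\<forall>j>n. s j = 0)"
      unfolding aw h by (simp add: s_def)
  next
    fix t assume t: "q_hermite n q = (\<Sum>j\<le>n. smult (t j) (askey_wilson j a b c d q)) \<and> (\<forall>j>n. t j = 0)"
    show "t = s"
    proof
      fix j
      show "t j = s j"
      proof (cases "j \<le> n")
        case True
        show ?thesis
          by (rule graded_basis_unique[where p = "aw_poly q a b c d", OF degree_aw_poly[OF q a two] _ True])
            (rule trans[OF sym[OF conjunct1[OF t, unfolded aw]] h])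
      next
        case False
        then show ?thesis using t by (simp add: s_def)
      qed
    qed
  qed
  then show ?thesis
    unfolding sigma_AW_H_def by (simp add: s_def kn \<tau>_def)
qed

section \<open>Sums over decreasing tuples\<close>

lemma to_fract_power: "to_fract (x ^ n) = to_fract x ^ n"
  by (induction n) simp_all

lemma series_const_simps [simp]:
  "series_const 0 = 0" "series_const 1 = 1"
  "series_const (x + y) = series_const x + series_const y"
  "series_const (x * y) = series_const x * series_const y"
  "series_const (x ^ n) = series_const x ^ n"
  by (simp_all add: series_const_def flip: fps_const_add fps_const_mult fps_const_power)

lemma series_const_eq_iff [simp]: "series_const x = series_const y \<longleftrightarrow> x = y"
  by (simp add: series_const_def)

lemma gbin_series_const: "gbin (series_const q) n k = series_const (gbin q n k)"
  by (induction q n k rule: gbin.induct) simp_all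

lemma not_root_of_unity_q_var: "not_root_of_unity q_var"
proof -
  have p: "q_var ^ i = to_fract ([:0, 1:] ^ i)" for i
    by (simp only: q_var_def to_fract_power)
  have "([:0, 1::complex:] ^ i) \<noteq> 1" if "i > 0" for i
  proof
    assume "[:0, 1::complex:] ^ i = 1"
    then have "degree ([:0, 1::complex:] ^ i) = 0" by simp
    then show False using that by (simp add: degree_power_eq)
  qed
  then show ?thesis
    unfolding not_root_of_unity_def p by (metis to_fract_1 to_fract_eq_iff)
qed

definition q_series :: series where "q_series = series_const q_var"

lemma not_root_of_unity_q_series: "not_root_of_unity q_series"
proof -
  have "q_series ^ i = 1 \<longleftrightarrow> q_var ^ i = 1" for i
    using series_const_eq_iff[of "q_var ^ i" 1] by (simp add: q_series_def)
  then show ?thesis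
    using not_root_of_unity_q_var by (simp add: not_root_of_unity_def)
qed

lemma qfact_qdiffs: "qfact q n = qdiffs q n / (1 - q) ^ n"
  by (induction n) (simp_all add: qfact_def)

lemma qmultinom_append:
  fixes q :: "'a::field"
  assumes q: "not_root_of_unity q" and "j \<le> n"
  shows "qmultinom q n k (ms @ [n - j]) = gbin q n j * qmultinom q j k ms"
proof -
  have "q \<noteq> 1"
    using q[unfolded not_root_of_unity_def, rule_format, of 1] by simp
  moreover have "(1 - q) ^ n = (1 - q) ^ j * (1 - q) ^ (n - j)"
    using assms(2) by (simp flip: power_add)
  moreover have "qdiffs q n = gbin q n j * qdiffs q j * qdiffs q (n - j)"
    using gbin_qdiffs[OF assms(2), of q] by simp
  ultimately have "qfact q n = gbin q n j * qfact q j * qfact q (n - j)" "qfact q (n - j) \<noteq> 0"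
    using qdiffs_neq_0[OF q] by (simp_all add: qfact_qdiffs)
  then show ?thesis
    by (simp add: qmultinom_def)
qed

lemma run_lengths_replicate: "run_lengths (replicate m x) = (if m = 0 then [] else [m])"
  by (cases m) (simp_all add: takeWhile_replicate dropWhile_replicate)

lemma takeWhile_append_replicate:
  assumes "\<not> P x"
  shows "takeWhile P (xs @ replicate m x) = takeWhile P xs"
    "dropWhile P (xs @ replicate m x) = dropWhile P xs @ replicate m x"
  using assms by (induction xs) (simp_all add: takeWhile_replicate dropWhile_replicate)

lemma run_lengths_append_replicate:
  "x \<notin> set xs \<Longrightarrow>
    run_lengths (xs @ replicate m x) = run_lengths xs @ (if m = 0 then [] else [m])"
proof (induction xs rule: run_lengths.induct)
  case 1
  show ?case using run_lengths_replicate[of m x] by simp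
next
  case (2 y ys)
  have "x \<notin> set (dropWhile (\<lambda>z. z = y) ys)"
    using 2(2) set_dropWhileD by fastforce
  moreover have "x \<noteq> y" using 2(2) by auto
  ultimately show ?case
    using 2(1) takeWhile_append_replicate[of "\<lambda>z. z = y" x ys m] by simp
qed

section \<open>Weights of tuples as entries of matrix products\<close>

definition weight :: "nat \<Rightarrow> nat \<Rightarrow> quad list \<Rightarrow> series" where
  "weight n k Ts = a_monom (tuple_sum Ts) *
     series_const (q_var ^ norm_nk n k Ts * qmultinom q_var n k (run_lengths Ts))"

definition quad_factor :: "quad \<Rightarrow> nat \<Rightarrow> series" where
  "quad_factor T i = a_monom T * q_series ^ (i * ((quad_size T - 1) div 2))"

lemma tuple_sum_append_replicate:
  "a_monom (tuple_sum (Ts @ replicate m T)) = a_monom (tuple_sum Ts) * a_monom T ^ m"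
proof -
  obtain t1 t2 t3 t4 where T: "T = (t1, t2, t3, t4)"
    by (metis prod_cases4)
  show ?thesis
    by (simp add: T tuple_sum_def sum_list_replicate power_add power_mult_distrib
        mult_ac flip: power_mult)
qed

lemma norm_nk_append_replicate:
  assumes "length Ts = j - k" "k \<le> j" "j \<le> n" "odd (quad_size T)"
  shows "norm_nk n k (Ts @ replicate (n - j) T) =
    norm_nk j k Ts + (\<Sum>i=j..<n. i * ((quad_size T - 1) div 2))"
proof -
  have half: "i * (quad_size T - 1) div 2 = i * ((quad_size T - 1) div 2)" for i
    using assms(4) by (simp add: div_mult_swap)
  let ?g = "\<lambda>i. i * (quad_size ((Ts @ replicate (n - j) T) ! (i - k)) - 1) div 2"
  have "norm_nk n k (Ts @ replicate (n - j) T) = (\<Sum>i=k..<j. ?g i) + (\<Sum>i=j..<n. ?g i)"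
    unfolding norm_nk_def using assms by (simp add: sum.atLeastLessThan_concat)
  also have "(\<Sum>i=k..<j. ?g i) = norm_nk j k Ts"
    unfolding norm_nk_def using assms by (intro sum.cong refl) (auto simp: nth_append)
  also have "(\<Sum>i=j..<n. ?g i) = (\<Sum>i=j..<n. i * ((quad_size T - 1) div 2))"
    using assms by (intro sum.cong refl) (auto simp: nth_append half[simplified])
  finally show ?thesis .
qed

lemma weight_append_replicate:
  assumes "length Ts = j - k" "k \<le> j" "j \<le> n" "odd (quad_size T)" "T \<notin> set Ts"
  shows "weight n k (Ts @ replicate (n - j) T) = mat q_series (quad_factor T) n j * weight j k Ts"
proof -
  \<comment> \<open>For j = n the appended run is empty and leaves no entry in
    \<open>run_lengths\<close>; the entry 0 listed instead contributes the q-factorial of 0, which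
    is 1.\<close>
  have rl: "qmultinom q_var n k (run_lengths (Ts @ replicate (n - j) T)) =
      qmultinom q_var n k (run_lengths Ts @ [n - j])"
    using assms(3) unfolding run_lengths_append_replicate[OF assms(5)]
    by (simp add: qmultinom_def qfact_def)
  have "mat q_series (quad_factor T) n j = series_const (gbin q_var n j) * (a_monom T ^ (n - j) *
      series_const (q_var ^ (\<Sum>i=j..<n. i * ((quad_size T - 1) div 2))))"
    by (simp add: mat_def quad_factor_def prod.distrib q_series_def gbin_series_const flip: power_sum)
  then show ?thesis
    unfolding weight_def tuple_sum_append_replicate norm_nk_append_replicate[OF assms(1-4)]
      rl qmultinom_append[OF not_root_of_unity_q_var assms(3)]
    by (simp add: power_add mult_ac)
qed

lemma weight_Nil [simp]: "weight n n [] = 1"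
proof -
  have "qfact q_var n \<noteq> 0"
    using qdiffs_neq_0[OF not_root_of_unity_q_var, of n] not_root_of_unity_q_var[unfolded not_root_of_unity_def, rule_format, of 1]
    by (simp add: qfact_qdiffs)
  then show ?thesis
    by (simp add: weight_def tuple_sum_def norm_nk_def qmultinom_def)
qed

text \<open>\<open>Tnk\<close> with the entries restricted to U. A finite U gives ordinary finite
  sums, to which the formal sum is reduced coefficient by coefficient.\<close>

definition decreasing_tuples :: "quad set \<Rightarrow> nat \<Rightarrow> quad list set" where
  "decreasing_tuples U l = {Ts. length Ts = l \<and> set Ts \<subseteq> U \<and> sorted_wrt (\<lambda>S T. quad_le T S) Ts}"

lemma finite_decreasing_tuples: "finite U \<Longrightarrow> finite (decreasing_tuples U l)"
  by (rule finite_subset[OF _ finite_lists_length_eq[of U l]]) (auto simp: decreasing_tuples_def)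

lemma quad_le_refl: "quad_le T T"
  by (metis prod_cases4 quad_le.simps lexordp_eq_refl)

lemma minimal_at_end:
  assumes "sorted_wrt (\<lambda>S T. quad_le T S) Ts" "set Ts \<subseteq> insert T U" "\<And>u. u \<in> U \<Longrightarrow> \<not> quad_le u T"
  shows "\<forall>x\<in>set (dropWhile (\<lambda>x. x \<noteq> T) Ts). x = T"
  using assms(1,2)
proof (induction Ts)
  case (Cons x xs)
  show ?case
  proof (cases "x = T")
    case True
    then have "quad_le y T" "y \<in> insert T U" if "y \<in> set xs" for y
      using Cons.prems that by auto
    then have "\<forall>y\<in>set xs. y = T"
      using assms(3) by blast
    moreover have "dropWhile (\<lambda>x. x \<noteq> T) (x # xs) = x # xs"
      using True by simp
    ultimately show ?thesis using True by (metis set_ConsD)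
  next
    case False
    have "\<forall>x\<in>set (dropWhile (\<lambda>x. x \<noteq> T) xs). x = T"
      by (rule Cons.IH) (use Cons.prems in auto)
    moreover have "dropWhile (\<lambda>x. x \<noteq> T) (x # xs) = dropWhile (\<lambda>x. x \<noteq> T) xs"
      using False by simp
    ultimately show ?thesis by (simp only:)
  qed
qed simp

definition unit_mat :: "nat \<Rightarrow> nat \<Rightarrow> 'a::comm_ring_1" where
  "unit_mat n k = of_bool (n = k)"

text \<open>\<open>R\<close> holds the place of the factors further to the right:
  \<open>unit_mat\<close> when the product is cut off, a rescaled \<open>tail_series\<close> when it
  is meant to continue forever.\<close>

definition chain_mat :: "quad list \<Rightarrow> (nat \<Rightarrow> nat \<Rightarrow> series) \<Rightarrow> nat \<Rightarrow> nat \<Rightarrow> series" where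
  "chain_mat Us R = foldr (\<lambda>T. mmul (mat q_series (quad_factor T))) Us R"

lemma chain_mat_simps [simp]:
  "chain_mat [] R = R"
  "chain_mat (T # Us) R = mmul (mat q_series (quad_factor T)) (chain_mat Us R)"
  "chain_mat (Us @ Vs) R = chain_mat Us (chain_mat Vs R)"
  by (simp_all add: chain_mat_def)

text \<open>The smallest entry \<open>T\<close> of a decreasing tuple occupies its end; splitting off this run peels
  off the factor of \<open>T\<close> from the left of the matrix product.\<close>

lemma sum_weight_decreasing_tuples:
  assumes "sorted_wrt (\<lambda>S T. quad_le S T \<and> \<not> quad_le T S) Us" "\<And>T. T \<in> set Us \<Longrightarrow> odd (quad_size T)" "k \<le> n"
  shows "(\<Sum>Ts\<in>decreasing_tuples (set Us) (n - k). weight n k Ts) = chain_mat Us unit_mat n k"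
  using assms
proof (induction Us arbitrary: n)
  case Nil
  have "decreasing_tuples (set []) (n - k) = (if n = k then {[]} else {})"
    using Nil(3) by (auto simp: decreasing_tuples_def)
  then show ?case by (simp add: unit_mat_def)
next
  case (Cons T Us)
  have le: "quad_le T u" "\<not> quad_le u T" if "u \<in> set Us" for u
    using Cons.prems(1) that by auto
  have T: "T \<notin> set Us"
    using le quad_le_refl by blast
  \<comment> \<open>The first component is the index at which the final run of T starts, counted
    from k like the entries themselves; it is n when T does not occur.\<close>
  define cut where "cut Ts = (k + length (takeWhile (\<lambda>x. x \<noteq> T) Ts), takeWhile (\<lambda>x. x \<noteq> T) Ts)" for Ts
  define glue where "glue = (\<lambda>(j, Ts). Ts @ replicate (n - j) T)"
  have "(\<Sum>Ts\<in>decreasing_tuples (set (T # Us)) (n - k). weight n k Ts) =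
      (\<Sum>(j, Ts)\<in>Sigma {k..n} (\<lambda>j. decreasing_tuples (set Us) (j - k)).
         weight n k (Ts @ replicate (n - j) T))"
  proof (rule sum.reindex_bij_witness[of _ glue cut])
    fix Ts assume Ts: "Ts \<in> decreasing_tuples (set (T # Us)) (n - k)"
    define A where "A = takeWhile (\<lambda>x. x \<noteq> T) Ts"
    define B where "B = dropWhile (\<lambda>x. x \<noteq> T) Ts"
    have AB: "Ts = A @ B"
      by (simp add: A_def B_def)
    have "\<forall>x\<in>set B. x = T"
      unfolding B_def by (rule minimal_at_end[of _ _ "set Us"]) (use Ts le in \<open>auto simp: decreasing_tuples_def\<close>)
    then have B: "B = replicate (length B) T"
      by (simp add: replicate_length_same)
    have len: "length A + length B = n - k"
      using Ts by (simp add: decreasing_tuples_def AB)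
    then have lB: "length B = n - (k + length A)"
      by simp
    have "set A \<subseteq> set Us"
      using Ts set_takeWhileD[of _ "\<lambda>x. x \<noteq> T" Ts] unfolding A_def decreasing_tuples_def by fastforce
    moreover have "sorted_wrt (\<lambda>S T. quad_le T S) A"
      using Ts by (simp add: decreasing_tuples_def AB sorted_wrt_append)
    ultimately have "A \<in> decreasing_tuples (set Us) (k + length A - k)"
      by (simp add: decreasing_tuples_def)
    then show "cut Ts \<in> Sigma {k..n} (\<lambda>j. decreasing_tuples (set Us) (j - k))"
      unfolding cut_def A_def[symmetric] using len Cons.prems(3) by auto
    have "A @ replicate (n - (k + length A)) T = Ts"
      using AB B lB by metis
    then show "glue (cut Ts) = Ts"
      by (simp add: cut_def glue_def A_def)
    then show "(case cut Ts of (j, Ts) \<Rightarrow> weight n k (Ts @ replicate (n - j) T)) = weight n k Ts"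
      by (simp add: glue_def split: prod.splits)
  next
    fix p assume "p \<in> Sigma {k..n} (\<lambda>j. decreasing_tuples (set Us) (j - k))"
    then obtain j Ts where p: "p = (j, Ts)" and j: "j \<in> {k..n}"
      and Ts: "Ts \<in> decreasing_tuples (set Us) (j - k)"
      by blast
    have nT: "x \<noteq> T" if "x \<in> set Ts" for x
      using that Ts T by (auto simp: decreasing_tuples_def)
    then have "takeWhile (\<lambda>x. x \<noteq> T) (Ts @ replicate (n - j) T) = Ts"
      by (simp add: takeWhile_append2 takeWhile_replicate)
    then show "cut (glue p) = p"
      using Ts j by (simp add: cut_def glue_def p decreasing_tuples_def)
    have "sorted_wrt (\<lambda>S T. quad_le T S) (replicate m T)" for m
      by (induction m) (simp_all add: quad_le_refl)
    then show "glue p \<in> decreasing_tuples (set (T # Us)) (n - k)"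
      using Ts j le by (auto simp: glue_def p decreasing_tuples_def sorted_wrt_append)
  qed
  also have "\<dots> = (\<Sum>j=k..n. \<Sum>Ts\<in>decreasing_tuples (set Us) (j - k). weight n k (Ts @ replicate (n - j) T))"
    by (rule sum.Sigma[symmetric]) (auto intro: finite_decreasing_tuples)
  also have "\<dots> = (\<Sum>j=k..n. mat q_series (quad_factor T) n j * chain_mat Us unit_mat j k)"
  proof (intro sum.cong refl)
    fix j assume j: "j \<in> {k..n}"
    have "(\<Sum>Ts\<in>decreasing_tuples (set Us) (j - k). weight n k (Ts @ replicate (n - j) T)) =
        (\<Sum>Ts\<in>decreasing_tuples (set Us) (j - k). mat q_series (quad_factor T) n j * weight j k Ts)"
      using j T Cons.prems(2)
      by (intro sum.cong refl weight_append_replicate) (auto simp: decreasing_tuples_def)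
    also have "\<dots> = mat q_series (quad_factor T) n j * chain_mat Us unit_mat j k"
      unfolding sum_distrib_left[symmetric] using Cons j by simp
    finally show "(\<Sum>Ts\<in>decreasing_tuples (set Us) (j - k). weight n k (Ts @ replicate (n - j) T)) =
        mat q_series (quad_factor T) n j * chain_mat Us unit_mat j k" .
  qed
  finally show ?case by (simp add: mmul_def)
qed

section \<open>Enumeration of the quadruples and merging of the blocks\<close>

text \<open>The entries of \<open>Tset\<close> with \<open>t\<^sub>4 = m + 1\<close>, in increasing order.\<close>

definition quad_block :: "nat \<Rightarrow> quad list" where
  "quad_block m = [(m, m, m, Suc m), (Suc m, Suc m, m, Suc m), (Suc m, m, Suc m, Suc m),
     (Suc (Suc m), Suc m, Suc m, Suc m), (m, Suc m, Suc m, Suc m),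
     (Suc m, Suc (Suc m), Suc m, Suc m), (Suc m, Suc m, Suc (Suc m), Suc m),
     (Suc (Suc m), Suc (Suc m), Suc (Suc m), Suc m)]"

fun quads_upto :: "nat \<Rightarrow> quad list" where
  "quads_upto 0 = [(1, 0, 0, 0), (0, 1, 0, 0), (0, 0, 1, 0), (1, 1, 1, 0)]"
| "quads_upto (Suc m) = quads_upto m @ quad_block m"

lemma Tset_iff:
  "(t1, t2, t3, t4) \<in> Tset \<longleftrightarrow> odd (t1 + t2 + t3 + t4) \<and>
     t1 \<le> Suc t2 \<and> t1 \<le> Suc t3 \<and> t1 \<le> Suc t4 \<and> t2 \<le> Suc t1 \<and> t2 \<le> Suc t3 \<and> t2 \<le> Suc t4 \<and>
     t3 \<le> Suc t1 \<and> t3 \<le> Suc t2 \<and> t3 \<le> Suc t4 \<and> t4 \<le> Suc t1 \<and> t4 \<le> Suc t2 \<and> t4 \<le> Suc t3"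
proof -
  have close: "\<bar>int x - int y\<bar> \<le> 1 \<longleftrightarrow> x \<le> Suc y \<and> y \<le> Suc x" for x y
    by linarith
  have refl: "x \<le> Suc x" for x
    by simp
  show ?thesis
    by (simp only: Tset_def mem_Collect_eq prod.case close refl ball_simps simp_thms) blast
qed

lemma block_subset: "set (quad_block m) \<subseteq> Tset"
  by (simp add: quad_block_def Tset_iff)

lemma set_block: "(t1, t2, t3, Suc m) \<in> set (quad_block m) \<longleftrightarrow> (t1, t2, t3, Suc m) \<in> Tset"
proof
  assume *: "(t1, t2, t3, Suc m) \<in> Tset"
  then have "t1 = m \<or> t1 = Suc m \<or> t1 = Suc (Suc m)" "t2 = m \<or> t2 = Suc m \<or> t2 = Suc (Suc m)"
    "t3 = m \<or> t3 = Suc m \<or> t3 = Suc (Suc m)"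
    unfolding Tset_iff by linarith+
  then show "(t1, t2, t3, Suc m) \<in> set (quad_block m)"
    using * unfolding Tset_iff quad_block_def by (elim disjE) simp_all
qed (use block_subset in blast)

lemma set_quads: "(t1, t2, t3, t4) \<in> set (quads_upto m) \<longleftrightarrow> (t1, t2, t3, t4) \<in> Tset \<and> t4 \<le> m"
proof (induction m)
  case 0
  show ?case
  proof
    assume *: "(t1, t2, t3, t4) \<in> Tset \<and> t4 \<le> 0"
    then have t4: "t4 = 0" and "t1 = 0 \<or> t1 = 1" "t2 = 0 \<or> t2 = 1" "t3 = 0 \<or> t3 = 1"
      unfolding Tset_iff by linarith+
    then show "(t1, t2, t3, t4) \<in> set (quads_upto 0)"
      using * unfolding Tset_iff t4 by (elim disjE) simp_all
  qed (auto simp: Tset_iff)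
next
  case (Suc m)
  have "t4 = Suc m" if "(t1, t2, t3, t4) \<in> set (quad_block m)"
    using that by (auto simp: quad_block_def)
  then show ?case
    using Suc set_block[of t1 t2 t3 m] by (auto simp: le_Suc_eq)
qed

lemma sorted_quads: "sorted_wrt (\<lambda>S T. quad_le S T \<and> \<not> quad_le T S) (quads_upto m)"
proof (induction m)
  case (Suc m)
  have "sorted_wrt (\<lambda>S T. quad_le S T \<and> \<not> quad_le T S) (quad_block m)"
    by (simp add: quad_block_def)
  moreover have "quad_le S T \<and> \<not> quad_le T S" if "S \<in> set (quads_upto m)" "T \<in> set (quad_block m)" for S T
  proof -
    obtain s1 s2 s3 s4 where S: "S = (s1, s2, s3, s4)"
      by (metis prod_cases4)
    have "s4 \<le> m" using that(1) by (simp add: S set_quads)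
    then show ?thesis using that(2) by (auto simp: S quad_block_def)
  qed
  ultimately show ?case
    using Suc by (simp add: sorted_wrt_append)
qed simp

lemma odd_quad_size: "T \<in> Tset \<Longrightarrow> odd (quad_size T)"
  by (cases T) (simp add: Tset_iff)

text \<open>The ratio of \<open>quad_factor\<close> at T + (1, 1, 1, 1) and at T: the size grows by
  4, hence the exponent i (|T| - 1) / 2 by 2 i.\<close>

definition shift_factor :: "nat \<Rightarrow> series" where
  "shift_factor i = a1 * a2 * a3 * a4 * q_series ^ (2 * i)"

text \<open>Multiplied out, its eight terms are the factors of the entries of
  \<open>quad_block 0\<close>.\<close>

definition tail_factor :: "nat \<Rightarrow> series" where
  "tail_factor i = a4 * (1 + a1 * a2 * q_series ^ i) * (1 + a1 * a3 * q_series ^ i) * (1 + a2 * a3 * q_series ^ i)"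

text \<open>Relative to the first factor \<open>g\<close>, the eight factors in increasing order are
  1, x, y, y x, z, z x, z y, z y x, each letter with its q^i. Merging neighbours that differ by x,
  then by y, then by z leaves one factor. The minus sign at t_1 in the order matters here: it puts y
  x, which has t_1 = m + 2, directly after y and before z, which has t_1 = m.\<close>

lemma chain_block: "chain_mat (quad_block m) R = mmul (mat q_series (\<lambda>i. shift_factor i ^ m * tail_factor i)) R"
proof -
  define g where "g i = shift_factor i ^ m * a4" for i
  define x where "x = a1 * a2"
  define y where "y = a1 * a3"
  define z where "z = a2 * a3"
  \<comment> \<open>\<open>r\<close> counts the letters x, y, z in the factor; each raises the size
    by 2, starting from |T| - 1 = 4 m.\<close>
  have pw: "q_series ^ (i * ((4 * m + 2 * r) div 2)) = (q_series ^ (2 * i)) ^ m * (q_series ^ i) ^ r" for i r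
  proof -
    have "i * ((4 * m + 2 * r) div 2) = 2 * i * m + i * r"
      by (simp add: algebra_simps)
    then show ?thesis by (simp only: power_add power_mult)
  qed
  have pws: "q_series ^ (i * ((4 * m) div 2)) = (q_series ^ (2 * i)) ^ m" for i
    using pw[of i 0] by simp
  have factors:
    "quad_factor (m, m, m, Suc m) = g"
    "quad_factor (Suc m, Suc m, m, Suc m) = (\<lambda>i. g i * (x * q_series ^ i))"
    "quad_factor (Suc m, m, Suc m, Suc m) = (\<lambda>i. g i * (y * q_series ^ i))"
    "quad_factor (Suc (Suc m), Suc m, Suc m, Suc m) = (\<lambda>i. g i * (y * q_series ^ i) * (x * q_series ^ i))"
    "quad_factor (m, Suc m, Suc m, Suc m) = (\<lambda>i. g i * (z * q_series ^ i))"
    "quad_factor (Suc m, Suc (Suc m), Suc m, Suc m) = (\<lambda>i. g i * (z * q_series ^ i) * (x * q_series ^ i))"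
    "quad_factor (Suc m, Suc m, Suc (Suc m), Suc m) = (\<lambda>i. g i * (z * q_series ^ i) * (y * q_series ^ i))"
    "quad_factor (Suc (Suc m), Suc (Suc m), Suc (Suc m), Suc m) =
       (\<lambda>i. g i * (z * q_series ^ i) * (y * q_series ^ i) * (x * q_series ^ i))"
  proof -
    have sz: "m + m + m + Suc m - 1 = 4 * m + 2 * 0"
      "Suc m + Suc m + m + Suc m - 1 = 4 * m + 2 * 1" "Suc m + m + Suc m + Suc m - 1 = 4 * m + 2 * 1"
      "Suc (Suc m) + Suc m + Suc m + Suc m - 1 = 4 * m + 2 * 2" "m + Suc m + Suc m + Suc m - 1 = 4 * m + 2 * 1"
      "Suc m + Suc (Suc m) + Suc m + Suc m - 1 = 4 * m + 2 * 2"
      "Suc m + Suc m + Suc (Suc m) + Suc m - 1 = 4 * m + 2 * 2"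
      "Suc (Suc m) + Suc (Suc m) + Suc (Suc m) + Suc m - 1 = 4 * m + 2 * 3"
      by simp_all
    show "quad_factor (m, m, m, Suc m) = g"
    "quad_factor (Suc m, Suc m, m, Suc m) = (\<lambda>i. g i * (x * q_series ^ i))"
    "quad_factor (Suc m, m, Suc m, Suc m) = (\<lambda>i. g i * (y * q_series ^ i))"
    "quad_factor (Suc (Suc m), Suc m, Suc m, Suc m) = (\<lambda>i. g i * (y * q_series ^ i) * (x * q_series ^ i))"
    "quad_factor (m, Suc m, Suc m, Suc m) = (\<lambda>i. g i * (z * q_series ^ i))"
    "quad_factor (Suc m, Suc (Suc m), Suc m, Suc m) = (\<lambda>i. g i * (z * q_series ^ i) * (x * q_series ^ i))"
    "quad_factor (Suc m, Suc m, Suc (Suc m), Suc m) = (\<lambda>i. g i * (z * q_series ^ i) * (y * q_series ^ i))"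
    "quad_factor (Suc (Suc m), Suc (Suc m), Suc (Suc m), Suc m) =
       (\<lambda>i. g i * (z * q_series ^ i) * (y * q_series ^ i) * (x * q_series ^ i))"
      unfolding quad_factor_def quad_size.simps sz pw g_def shift_factor_def x_def y_def z_def a_monom.simps
        power_mult_distrib power_Suc
      by (intro ext; simp add: mult_ac power2_eq_square power3_eq_cube)+
  qed
  note merge = mmul_mat_merge[OF not_root_of_unity_q_series]
  have "chain_mat (quad_block m) R =
    mmul (mat q_series (\<lambda>i. g i * (1 + x * q_series ^ i) * (1 + y * q_series ^ i) * (1 + z * q_series ^ i))) R"
    unfolding quad_block_def chain_mat_simps factors
    apply (subst merge[of "\<lambda>i. g i * (z * q_series ^ i) * (y * q_series ^ i) * (x * q_series ^ i)" _ x], rule refl)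
    apply (subst merge[of "\<lambda>i. g i * (z * q_series ^ i) * (x * q_series ^ i)" _ x], rule refl)
    apply (subst merge[of _ "\<lambda>i. g i * (z * q_series ^ i) * (1 + x * q_series ^ i)" y], simp only: mult_ac)
    apply (subst merge[of "\<lambda>i. g i * (y * q_series ^ i) * (x * q_series ^ i)" _ x], rule refl)
    apply (subst merge[of "\<lambda>i. g i * (x * q_series ^ i)" g x], rule refl)
    apply (subst merge[of _ "\<lambda>i. g i * (1 + x * q_series ^ i)" y], simp only: mult_ac)
    apply (subst merge[of _ "\<lambda>i. g i * (1 + x * q_series ^ i) * (1 + y * q_series ^ i)" z], simp only: mult_ac)
    apply (rule refl)
    done
  also have "(\<lambda>i. g i * (1 + x * q_series ^ i) * (1 + y * q_series ^ i) * (1 + z * q_series ^ i)) = (\<lambda>i. shift_factor i ^ m * tail_factor i)"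
    by (simp add: g_def tail_factor_def x_def y_def z_def mult_ac)
  finally show ?thesis .
qed

text \<open>The geometric series in a_4 with ratio a_1 a_2 a_3 q^i taken from the ring of
  coefficients. That ring is not a field, so the reciprocal is written out.\<close>

definition geom :: "nat \<Rightarrow> series" where
  "geom i = Abs_fps (\<lambda>n. (fps_const (fps_const fps_X) * fps_const fps_X * fps_X *
     fps_const (fps_const (fps_const (q_var ^ i)))) ^ n)"

lemma geom_inverse: "geom i * (1 - a1 * a2 * a3 * a4 * q_series ^ i) = 1"
proof -
  define c where "c = fps_const (fps_const fps_X) * fps_const fps_X * fps_X *
     fps_const (fps_const (fps_const (q_var ^ i)))"
  have "fps_const c * fps_X = a1 * a2 * a3 * a4 * q_series ^ i"
    by (simp add: c_def a1_def a2_def a3_def a4_def q_series_def mult_ac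
        flip: series_const_simps fps_const_mult) (simp add: series_const_def mult_ac)
  moreover have "geom i = 1 + fps_const c * fps_X * geom i"
    unfolding geom_def c_def[symmetric]
    by (rule fps_ext) (simp add: mult.assoc power_eq_if)
  ultimately show ?thesis
    by (metis (no_types, lifting) add_diff_cancel_right' mult.commute mult_1 right_diff_distrib')
qed

section \<open>The infinite product and its truncations\<close>

definition tail_series :: "nat \<Rightarrow> nat \<Rightarrow> series" where
  "tail_series = tail_mat q_series geom tail_factor"

text \<open>The product up to t_4 = m times the remainder does not depend on m: the fixed-point
  equation, rescaled by the m-th power of \<open>shift_factor\<close>, splits
  \<open>quad_block m\<close> off the remainder.\<close>

lemma chain_quads_tail: "chain_mat (quads_upto m) (scale (\<lambda>i. shift_factor i ^ m) tail_series) = chain_mat (quads_upto 0) tail_series"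
proof (induction m)
  case (Suc m)
  have tail_series: "tail_series = mmul (mat q_series tail_factor) (scale shift_factor tail_series)"
    unfolding tail_series_def shift_factor_def[abs_def] by (rule tail_mat_unfold[OF not_root_of_unity_q_series geom_inverse])
  have "chain_mat (quad_block m) (scale (\<lambda>i. shift_factor i ^ Suc m) tail_series) =
      scale (\<lambda>i. shift_factor i ^ m) (mmul (mat q_series tail_factor) (scale shift_factor tail_series))"
    unfolding chain_block scale_mmul scale_mat scale_scale by (simp add: mult.commute)
  then show ?case
    using Suc by (simp only: quads_upto.simps chain_mat_simps tail_series[symmetric])
qed simp

text \<open>Multiplication by fixed matrices preserves entrywise congruence modulo d. This takes the
  place of a limit argument.\<close>

lemma chain_mat_dvd_diff:
  assumes "\<And>n k. d dvd A n k - B n k"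
  shows "d dvd chain_mat Us A n k - chain_mat Us B n k"
proof (induction Us arbitrary: n k)
  case (Cons T Us)
  have "chain_mat (T # Us) A n k - chain_mat (T # Us) B n k =
      (\<Sum>j=k..n. mat q_series (quad_factor T) n j * (chain_mat Us A j k - chain_mat Us B j k))"
    by (simp add: mmul_def sum_subtractf algebra_simps)
  also have "d dvd \<dots>"
    by (intro dvd_sum dvd_mult Cons)
  finally show ?case .
qed (use assms in simp)

text \<open>Both sides contribute the same factors up to \<open>t\<^sub>4 = m\<close>, and the remaining factor is the identity
  modulo \<open>a\<^sub>4\<^sup>m\<close>.\<close>

lemma truncation_dvd:
  "a4 ^ m dvd chain_mat (quads_upto 0) tail_series n k - chain_mat (quads_upto m) unit_mat n k"
  unfolding chain_quads_tail[of m, symmetric]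
proof (rule chain_mat_dvd_diff)
  fix n k
  show "a4 ^ m dvd scale (\<lambda>i. shift_factor i ^ m) tail_series n k - unit_mat n k"
  proof (cases "k < n")
    case True
    then have "(\<Prod>i=k..<n. shift_factor i ^ m) = shift_factor k ^ m * (\<Prod>i=Suc k..<n. shift_factor i ^ m)"
      by (rule prod.atLeast_Suc_lessThan)
    moreover have "a4 ^ m dvd shift_factor k ^ m"
      by (rule dvd_power_same) (simp add: shift_factor_def)
    ultimately show ?thesis
      using True by (simp add: scale_def unit_mat_def)
  next
    case False
    then show ?thesis
      by (cases "k = n") (simp_all add: scale_def tail_series_def tail_mat_def mat_def unit_mat_def)
  qed
qed

lemma a4_power_dvd_coeff:
  assumes "a4 ^ m dvd f" "e4 < m"
  shows "series_coeff f (e1, e2, e3, e4) = 0"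
  using assms by (auto simp: a4_def fps_X_power_mult_nth elim!: dvdE)

lemma series_coeff_sum: "series_coeff (sum f A) e = (\<Sum>x\<in>A. series_coeff (f x) e)"
  by (cases e) (simp add: fps_sum_nth)

text \<open>The power of a_4 in a weight is the sum of the t_4 of all entries. A fixed monomial thus
  bounds every t_4, and with it the whole quadruple, as its entries differ by at most 1. Only
  finitely many tuples remain, and their sum is a finite chain product congruent to the closed
  form.\<close>

theorem has_formal_sum_weight:
  assumes "k \<le> n"
  shows "has_formal_sum (weight n k) (Tnk n k) (chain_mat (quads_upto 0) tail_series n k)"
  unfolding has_formal_sum_def
proof (intro allI)
  fix e :: quad
  obtain e1 e2 e3 e4 where e: "e = (e1, e2, e3, e4)"
    by (metis prod_cases4)
  \<comment> \<open>Congruence modulo a_4^m fixes only the coefficients at exponents below m, so m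
    has to exceed e4.\<close>
  define m where "m = Suc e4"
  define D where "D = decreasing_tuples (set (quads_upto m)) (n - k)"
  define N where "N = {Ts \<in> Tnk n k. series_coeff (weight n k Ts) e \<noteq> 0}"
  have fin: "finite D"
    unfolding D_def by (rule finite_decreasing_tuples) simp
  have "set (quads_upto m) \<subseteq> Tset"
    using set_quads by auto
  then have DT: "D \<subseteq> Tnk n k"
    by (auto simp: D_def Tnk_def decreasing_tuples_def)
  have ND: "N \<subseteq> D"
  proof
    fix Ts assume Ts: "Ts \<in> N"
    define t where "t = sum_list (map (\<lambda>(t1, t2, t3, t4). t4) Ts)"
    have "a4 ^ t dvd weight n k Ts"
      by (simp add: weight_def tuple_sum_def t_def)
    then have t: "t \<le> e4"
      using Ts a4_power_dvd_coeff[of t _ e4 e1 e2 e3] by (auto simp: N_def e not_less[symmetric])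
    have "(t1, t2, t3, t4) \<in> set (quads_upto m)" if "(t1, t2, t3, t4) \<in> set Ts" for t1 t2 t3 t4
    proof -
      have "t4 \<in> set (map (\<lambda>(t1, t2, t3, t4). t4) Ts)"
        using that by force
      then have "t4 \<le> t"
        unfolding t_def by (rule member_le_sum_list) simp
      then show ?thesis
        using Ts t that by (auto simp: set_quads m_def N_def Tnk_def)
    qed
    then show "Ts \<in> D"
      using Ts by (auto simp: N_def D_def Tnk_def decreasing_tuples_def)
  qed
  have "series_coeff (chain_mat (quads_upto 0) tail_series n k) e = series_coeff (chain_mat (quads_upto m) unit_mat n k) e"
    using a4_power_dvd_coeff[OF truncation_dvd, of e4 m n k e1 e2 e3]
    by (simp add: e m_def)
  also have "\<dots> = (\<Sum>Ts\<in>D. series_coeff (weight n k Ts) e)"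
    unfolding D_def series_coeff_sum[symmetric]
    by (subst sum_weight_decreasing_tuples[OF sorted_quads])
      (use assms odd_quad_size \<open>set (quads_upto m) \<subseteq> Tset\<close> in auto)
  also have "\<dots> = (\<Sum>Ts\<in>N. series_coeff (weight n k Ts) e)"
    by (rule sum.mono_neutral_right[OF fin ND]) (use DT in \<open>auto simp: N_def\<close>)
  finally show "finite {Ts \<in> Tnk n k. series_coeff (weight n k Ts) e \<noteq> 0} \<and>
      series_coeff (chain_mat (quads_upto 0) tail_series n k) e =
      (\<Sum>Ts | Ts \<in> Tnk n k \<and> series_coeff (weight n k Ts) e \<noteq> 0. series_coeff (weight n k Ts) e)"
    using finite_subset[OF ND fin] unfolding N_def by simp
qed

lemma chain_quads_0:
  "chain_mat (quads_upto 0) R = mmul (mat q_series (\<lambda>_. a1)) (mmul (mat q_series (\<lambda>_. a2))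
     (mmul (mat q_series (\<lambda>i. a3 * (1 + a1 * a2 * q_series ^ i))) R))"
proof -
  have "quad_factor (1, 0, 0, 0) = (\<lambda>_. a1)" "quad_factor (0, 1, 0, 0) = (\<lambda>_. a2)" "quad_factor (0, 0, 1, 0) = (\<lambda>_. a3)"
    "quad_factor (1, 1, 1, 0) = (\<lambda>i. a3 * (a1 * a2 * q_series ^ i))"
    by (simp_all add: quad_factor_def fun_eq_iff mult_ac)
  then show ?thesis
    unfolding quads_upto.simps chain_mat_simps
    by (simp only: mmul_mat_merge[OF not_root_of_unity_q_series, of "\<lambda>i. a3 * (a1 * a2 * q_series ^ i)" "\<lambda>_. a3" "a1 * a2" R])
qed

section \<open>Transfer to the field of fractions\<close>

lemma to_fract_prod: "to_fract (prod f A) = (\<Prod>x\<in>A. to_fract (f x))"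
  by (induction A rule: infinite_finite_induct) simp_all

lemma to_fract_gbin: "to_fract (gbin q n k) = gbin (to_fract q) n k"
  by (induction q n k rule: gbin.induct) (simp_all add: to_fract_power)

lemma to_fract_mat: "to_fract (mat q f n k) = mat (to_fract q) (\<lambda>i. to_fract (f i)) n k"
  by (simp add: mat_def to_fract_gbin to_fract_prod)

lemma to_fract_mmul:
  "to_fract (mmul A B n k) = mmul (\<lambda>n k. to_fract (A n k)) (\<lambda>n k. to_fract (B n k)) n k"
  by (simp add: mmul_def)

lemma scale_const: "scale (\<lambda>_. c) A n k = c ^ (n - k) * A n k"
  by (simp add: scale_def)

definition coeff0 :: "series \<Rightarrow> scalar" where "coeff0 f = f $ 0 $ 0 $ 0 $ 0"

lemma one_minus_neq_0:
  assumes "coeff0 f = 0"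
  shows "1 - emb f \<noteq> 0"
proof
  assume "1 - emb f = 0"
  then have "f = 1"
    by (metis eq_iff_diff_eq_0 to_fract_1 to_fract_eq_iff)
  then show False using assms by (simp add: coeff0_def)
qed

text \<open>Replacing each parameter by its multiple by \<iota> changes the sign of the products of
  two parameters, which gives the factors 1 + a_1 a_2 q^i, and keeps the product of all four. Each
  of the four matrices is then \<open>scale\<close> by the constant \<iota> of its counterpart over
  the power series. Since \<open>scale\<close> passes through products, \<iota>^(n - k) comes out in
  front and cancels against the normalization.\<close>

theorem sigma_tilde_eq:
  assumes "k \<le> n"
  shows "sigma_tilde imag_unit n k (emb a1) (emb a2) (emb a3) (emb a4) (emb q_series) =
    emb (chain_mat (quads_upto 0) tail_series n k)"
proof -
  define \<iota> where "\<iota> = imag_unit"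
  define q where "q = emb q_series"
  define a b c d where abcd: "a = emb a1" "b = emb a2" "c = emb a3" "d = emb a4"
  have "\<iota> * \<iota> = emb (series_const (to_fract ([:\<i>:] * [:\<i>:])))"
    unfolding \<iota>_def imag_unit_def by (simp only: to_fract_mult series_const_simps)
  also have "[:\<i>:] * [:\<i>:] = - 1"
    by (simp add: one_pCons)
  also have "emb (series_const (to_fract (- 1))) = - 1"
    using series_const_simps(3)[of 1 "- 1"] by (simp add: add_eq_0_iff)
  finally have ii: "\<iota> * \<iota> = - 1" .
  then have i0: "\<iota> \<noteq> 0" by auto
  have ii': "(\<iota> * x) * (\<iota> * y) = - (x * y)" for x y
  proof -
    have "(\<iota> * x) * (\<iota> * y) = (\<iota> * \<iota>) * (x * y)"
      by (simp only: mult_ac)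
    then show ?thesis by (simp add: ii)
  qed
  have q: "not_root_of_unity q" "q \<noteq> 0"
  proof -
    show "not_root_of_unity q"
      using not_root_of_unity_q_series unfolding not_root_of_unity_def q_def
      by (metis to_fract_1 to_fract_eq_iff to_fract_power)
    have "q_var \<noteq> 0" by (simp add: q_var_def)
    then have "q_series \<noteq> 0"
      unfolding q_series_def using series_const_eq_iff[of q_var 0] by simp
    then show "q \<noteq> 0" by (simp add: q_def)
  qed
  have two: "(2 :: series fract) \<noteq> 0"
  proof -
    have "(2 :: complex poly) \<noteq> 0" by simp
    then have "emb (series_const (to_fract (1 + 1))) \<noteq> 0"
      by (metis one_add_one series_const_eq_iff series_const_simps(1) to_fract_eq_0_iff)
    also have "emb (series_const (to_fract (1 + 1))) = 2"
      by (simp only: to_fract_add series_const_simps to_fract_1) simp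
    finally show ?thesis .
  qed
  have "a \<noteq> 0"
    by (simp add: abcd a1_def)
  then have a: "\<iota> * a \<noteq> 0" using i0 by simp
  have prods: "(\<iota> * a) * (\<iota> * b) = - (a * b)" "(\<iota> * a) * (\<iota> * c) = - (a * c)"
    "(\<iota> * a) * (\<iota> * d) = - (a * d)" "(\<iota> * b) * (\<iota> * c) = - (b * c)"
    "- (a * b) * (\<iota> * c) * (\<iota> * d) = a * b * c * d"
    by (simp_all only: ii' mult.assoc[of _ "\<iota> * c"]) simp
  have vanish: "coeff0 (- (a1 * x * q_series ^ i)) = 0" "coeff0 (a1 * x * q_series ^ i) = 0" for x i
    by (simp_all add: coeff0_def a1_def)
  have embs: "- (a * b) * q ^ i = emb (- (a1 * a2 * q_series ^ i))" "- (a * c) * q ^ i = emb (- (a1 * a3 * q_series ^ i))"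
    "- (a * d) * q ^ i = emb (- (a1 * a4 * q_series ^ i))"
    "a * b * c * d * q ^ i = emb (a1 * (a2 * a3 * a4) * q_series ^ i)" for i
    by (simp_all add: abcd q_def to_fract_power mult.assoc)
  have nz: "1 - \<iota> * a * (\<iota> * b) * q ^ i \<noteq> 0" "1 - \<iota> * a * (\<iota> * c) * q ^ i \<noteq> 0"
    "1 - \<iota> * a * (\<iota> * d) * q ^ i \<noteq> 0" "1 - \<iota> * a * (\<iota> * b) * (\<iota> * c) * (\<iota> * d) * q ^ i \<noteq> 0" for i
    unfolding prods embs by (intro one_minus_neq_0 vanish)+
  define A B C L where
    "A = (\<lambda>n k. emb (mat q_series (\<lambda>_. a1) n k))" and "B = (\<lambda>n k. emb (mat q_series (\<lambda>_. a2) n k))" and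
    "C = (\<lambda>n k. emb (mat q_series (\<lambda>i. a3 * (1 + a1 * a2 * q_series ^ i)) n k))" and
    "L = (\<lambda>n k. emb (tail_series n k))"
  have A: "mat q (\<lambda>_. \<iota> * a) = scale (\<lambda>_. \<iota>) A"
    and B: "mat q (\<lambda>_. \<iota> * b) = scale (\<lambda>_. \<iota>) B"
    unfolding A_def B_def to_fract_mat scale_mat by (simp_all add: abcd q_def)
  have C: "mat q (\<lambda>i. \<iota> * c * (1 - \<iota> * a * (\<iota> * b) * q ^ i)) = scale (\<lambda>_. \<iota>) C"
    unfolding C_def to_fract_mat scale_mat prods by (simp add: abcd q_def to_fract_power mult.assoc)
  have L: "aw_step q (\<iota> * a) (\<iota> * b) (\<iota> * c) (\<iota> * d) = scale (\<lambda>_. \<iota>) L"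
  proof -
    have geom: "1 / (1 - a * b * c * d * q ^ i) = emb (geom i)" for i
    proof -
      have "emb (geom i) * (1 - a * b * c * d * q ^ i) = emb (geom i * (1 - a1 * a2 * a3 * a4 * q_series ^ i))"
        by (simp add: abcd q_def to_fract_power)
      also have "\<dots> = 1"
        unfolding geom_inverse by simp
      finally show ?thesis
        by (metis div_by_1 divide_eq_eq mult_zero_right one_divide_eq_0_iff zero_neq_one)
    qed
    have tail_factor: "\<iota> * d * (1 - - (a * b) * q ^ i) * (1 - - (a * c) * q ^ i) * (1 - - (b * c) * q ^ i) = \<iota> * emb (tail_factor i)" for i
      by (simp add: tail_factor_def abcd q_def to_fract_power mult.assoc)
    have "scale (\<lambda>_. \<iota>) L = (\<lambda>n k. scale (\<lambda>_. \<iota>) (mat q (\<lambda>i. emb (tail_factor i))) n k * (\<Prod>i=k..<n. emb (geom (k + i))))"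
      by (intro ext) (simp add: scale_def L_def tail_series_def tail_mat_def to_fract_mat to_fract_prod q_def)
    then show ?thesis
      unfolding aw_step_def tail_mat_def prods geom tail_factor scale_mat by simp
  qed
  have "emb (chain_mat (quads_upto 0) tail_series n k) = mmul A (mmul B (mmul C L)) n k"
    unfolding chain_quads_0 to_fract_mmul A_def B_def C_def L_def ..
  moreover have "sigma_AW_H n k (\<iota> * a) (\<iota> * b) (\<iota> * c) (\<iota> * d) q =
      \<iota> ^ (n - k) * mmul A (mmul B (mmul C L)) n k / 2 ^ (n - k)"
    unfolding sigma_AW_H_eq[OF q a two nz assms] A B C L scale_mmul[symmetric] scale_const ..
  ultimately show ?thesis
    unfolding sigma_tilde_def \<iota>_def[symmetric] q_def[symmetric] abcd[symmetric]
    using two i0 by simp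
qed

theorem theorem6p5:
  fixes n k :: nat
  assumes "k \<le> n"
  shows "\<exists>S. has_formal_sum
               (\<lambda>Ts. a_monom (tuple_sum Ts) *
                  series_const (q_var ^ norm_nk n k Ts * qmultinom q_var n k (run_lengths Ts)))
               (Tnk n k) S \<and>
             sigma_tilde imag_unit n k (emb a1) (emb a2) (emb a3) (emb a4)
               (emb (series_const q_var)) = emb S"
proof (rule exI, rule conjI)
  show "has_formal_sum
      (\<lambda>Ts. a_monom (tuple_sum Ts) *
         series_const (q_var ^ norm_nk n k Ts * qmultinom q_var n k (run_lengths Ts)))
      (Tnk n k) (chain_mat (quads_upto 0) tail_series n k)"
    unfolding weight_def[symmetric] by (rule has_formal_sum_weight[OF assms])
  show "sigma_tilde imag_unit n k (emb a1) (emb a2) (emb a3) (emb a4) (emb (series_const q_var)) =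
      emb (chain_mat (quads_upto 0) tail_series n k)"
    unfolding q_series_def[symmetric] by (rule sigma_tilde_eq[OF assms])
qed

end
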